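(* There is an adjunction between fibrations over $\mathbf{Cring}$ $$\mathbb{S}\mathrm{ym}\dashv\mathbb{U}\mathrm{nd},\qquad\mathbb{S}\mathrm{ym}:\mathcal{Mod}\to\mathcal{CAlg},\qquad\mathbb{U}\mathrm{nd}:\mathcal{CAlg}\to\mathcal{Mod},$$ where $\mathbb{U}\mathrm{nd}(R,A):=(R,\mathrm{Und}_R(A))$ for all objects $(R,A)$ of $\mathcal{CAlg}$ and $\mathbb{S}\mathrm{ym}(S,M):=(S,\mathrm{Sym}_S(M))$ for all objects $(S,M)$ of $\mathcal{Mod}$.
   Context: $\mathbf{Cring}$ is the category of commutative rings. $\mathcal{Mod}$ has objects $(R,M)$ with $R$ a commutative ring and $M$ an $R$-module; a morphism $(R,M)\to(S,N)$ is a pair $(f,\rho)$ with $f:R\to S$ a ring map and $\rho:M\to\mathrm{res}_f(N)$ an $R$-module map ($\mathrm{res}_f$ is restriction of scalars). $\mathcal{CAlg}$ has objects $(R,A)$ with $R$ a commutative ring and $A$ a commutative $R$-algebra; a morphism $(R,A)\to(S,B)$ is a pair $(f,\rho)$ with $f:R\to S$ a ring map and $\rho:A\to W_f(B)$ an $R$-algebra map, where $W_f(B)$ is $B$ regarded as an $R$-algebra along $f$. In both cases composition is $(g,\varphi)\circ(f,\rho)=(g\circ f,\varphi\circ\rho)$ (with $\varphi$ restricted along $f$), and the fibration is the projection to the first component. $\mathrm{Und}_R(A)$ is the underlying $R$-module of $A$ and $\mathrm{Sym}_R(M)$ is the symmetric $R$-algebra on $M$. The adjunction is over $\mathbf{Cring}$,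 i.e. compatible with the two projections. *)

theory Defs
  imports
    "HOL-Library.Multiset"
    "HOL-Library.Infinite_Typeclass"
    "HOL-Algebra.QuotRing"
    "HOL-Algebra.Module"
begin

section \<open>Categories, functors, fibrations and adjunctions over a base\<close>

text \<open>Arrows do not determine their endpoints: hom-sets may overlap, and composition, identities and
  functors take the objects involved as arguments. \<open>Comp C X Y Z g f\<close> is the composite of
  \<open>f : X \<rightarrow> Y\<close> followed by \<open>g : Y \<rightarrow> Z\<close>.\<close>

record ('o, 'm) category =
  Ob :: "'o set"
  Hom :: "'o \<Rightarrow> 'o \<Rightarrow> 'm set"
  Ident :: "'o \<Rightarrow> 'm"
  Comp :: "'o \<Rightarrow> 'o \<Rightarrow> 'o \<Rightarrow> 'm \<Rightarrow> 'm \<Rightarrow> 'm"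

definition is_category :: "('o, 'm) category \<Rightarrow> bool" where
  "is_category C \<longleftrightarrow>
     (\<forall>X\<in>Ob C. Ident C X \<in> Hom C X X) \<and>
     (\<forall>X\<in>Ob C. \<forall>Y\<in>Ob C. \<forall>Z\<in>Ob C. \<forall>f\<in>Hom C X Y. \<forall>g\<in>Hom C Y Z.
        Comp C X Y Z g f \<in> Hom C X Z) \<and>
     (\<forall>X\<in>Ob C. \<forall>Y\<in>Ob C. \<forall>f\<in>Hom C X Y.
        Comp C X Y Y (Ident C Y) f = f \<and> Comp C X X Y f (Ident C X) = f) \<and>
     (\<forall>W\<in>Ob C. \<forall>X\<in>Ob C. \<forall>Y\<in>Ob C. \<forall>Z\<in>Ob C.
        \<forall>f\<in>Hom C W X. \<forall>g\<in>Hom C X Y. \<forall>h\<in>Hom C Y Z.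
        Comp C W Y Z h (Comp C W X Y g f) = Comp C W X Z (Comp C X Y Z h g) f)"

record ('o, 'm, 'p, 'n) cat_functor =
  omap :: "'o \<Rightarrow> 'p"
  amap :: "'o \<Rightarrow> 'o \<Rightarrow> 'm \<Rightarrow> 'n"

definition is_functor ::
    "('o, 'm) category \<Rightarrow> ('p, 'n) category \<Rightarrow> ('o, 'm, 'p, 'n) cat_functor \<Rightarrow> bool" where
  "is_functor C D F \<longleftrightarrow>
     is_category C \<and> is_category D \<and>
     (\<forall>X\<in>Ob C. omap F X \<in> Ob D) \<and>
     (\<forall>X\<in>Ob C. \<forall>Y\<in>Ob C. \<forall>f\<in>Hom C X Y. amap F X Y f \<in> Hom D (omap F X) (omap F Y)) \<and>
     (\<forall>X\<in>Ob C. amap F X X (Ident C X) = Ident D (omap F X)) \<and>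
     (\<forall>X\<in>Ob C. \<forall>Y\<in>Ob C. \<forall>Z\<in>Ob C. \<forall>f\<in>Hom C X Y. \<forall>g\<in>Hom C Y Z.
        amap F X Z (Comp C X Y Z g f) =
        Comp D (omap F X) (omap F Y) (omap F Z) (amap F Y Z g) (amap F X Y f))"

definition id_functor :: "('o, 'm, 'o, 'm) cat_functor" where
  "id_functor = \<lparr>omap = (\<lambda>X. X), amap = (\<lambda>X Y f. f)\<rparr>"

definition comp_functor ::
    "('p, 'n, 'q, 'k) cat_functor \<Rightarrow> ('o, 'm, 'p, 'n) cat_functor \<Rightarrow> ('o, 'm, 'q, 'k) cat_functor" where
  "comp_functor G F =
     \<lparr>omap = (\<lambda>X. omap G (omap F X)),
      amap = (\<lambda>X Y f. amap G (omap F X) (omap F Y) (amap F X Y f))\<rparr>"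

definition is_natural ::
    "('o, 'm) category \<Rightarrow> ('p, 'n) category \<Rightarrow> ('o, 'm, 'p, 'n) cat_functor \<Rightarrow>
     ('o, 'm, 'p, 'n) cat_functor \<Rightarrow> ('o \<Rightarrow> 'n) \<Rightarrow> bool" where
  "is_natural C D F G \<eta> \<longleftrightarrow>
     is_functor C D F \<and> is_functor C D G \<and>
     (\<forall>X\<in>Ob C. \<eta> X \<in> Hom D (omap F X) (omap G X)) \<and>
     (\<forall>X\<in>Ob C. \<forall>Y\<in>Ob C. \<forall>f\<in>Hom C X Y.
        Comp D (omap F X) (omap F Y) (omap G Y) (\<eta> Y) (amap F X Y f) =
        Comp D (omap F X) (omap G X) (omap G Y) (amap G X Y f) (\<eta> X))"

definition is_adjunction ::
    "('o, 'm) category \<Rightarrow> ('p, 'n) category \<Rightarrow> ('o, 'm, 'p, 'n) cat_functor \<Rightarrow>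
     ('p, 'n, 'o, 'm) cat_functor \<Rightarrow> ('o \<Rightarrow> 'm) \<Rightarrow> ('p \<Rightarrow> 'n) \<Rightarrow> bool" where
  "is_adjunction C D F G \<eta> \<epsilon> \<longleftrightarrow>
     is_functor C D F \<and> is_functor D C G \<and>
     is_natural C C id_functor (comp_functor G F) \<eta> \<and>
     is_natural D D (comp_functor F G) id_functor \<epsilon> \<and>
     (\<forall>X\<in>Ob C.
        Comp D (omap F X) (omap F (omap G (omap F X))) (omap F X)
          (\<epsilon> (omap F X)) (amap F X (omap G (omap F X)) (\<eta> X)) = Ident D (omap F X)) \<and>
     (\<forall>Y\<in>Ob D.
        Comp C (omap G Y) (omap G (omap F (omap G Y))) (omap G Y)
          (amap G (omap F (omap G Y)) Y (\<epsilon> Y)) (\<eta> (omap G Y)) = Ident C (omap G Y))"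

definition is_cartesian ::
    "('o, 'm) category \<Rightarrow> ('b, 'k) category \<Rightarrow> ('o, 'm, 'b, 'k) cat_functor \<Rightarrow>
     'o \<Rightarrow> 'o \<Rightarrow> 'm \<Rightarrow> bool" where
  "is_cartesian E B P X Y f \<longleftrightarrow>
     f \<in> Hom E X Y \<and>
     (\<forall>Z\<in>Ob E. \<forall>g\<in>Hom E Z Y. \<forall>w\<in>Hom B (omap P Z) (omap P X).
        Comp B (omap P Z) (omap P X) (omap P Y) (amap P X Y f) w = amap P Z Y g \<longrightarrow>
        (\<exists>!h. h \<in> Hom E Z X \<and> amap P Z X h = w \<and> Comp E Z X Y f h = g))"

definition is_fibration ::
    "('o, 'm) category \<Rightarrow> ('b, 'k) category \<Rightarrow> ('o, 'm, 'b, 'k) cat_functor \<Rightarrow> bool" where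
  "is_fibration E B P \<longleftrightarrow>
     is_functor E B P \<and>
     (\<forall>Y\<in>Ob E. \<forall>I\<in>Ob B. \<forall>u\<in>Hom B I (omap P Y).
        \<exists>X\<in>Ob E. \<exists>f. omap P X = I \<and> amap P X Y f = u \<and> is_cartesian E B P X Y f)"

definition is_functor_over ::
    "('o, 'm) category \<Rightarrow> ('p, 'n) category \<Rightarrow> ('o, 'm, 'b, 'k) cat_functor \<Rightarrow>
     ('p, 'n, 'b, 'k) cat_functor \<Rightarrow> ('o, 'm, 'p, 'n) cat_functor \<Rightarrow> bool" where
  "is_functor_over C D P Q F \<longleftrightarrow>
     is_functor C D F \<and>
     (\<forall>X\<in>Ob C. omap Q (omap F X) = omap P X) \<and>
     (\<forall>X\<in>Ob C. \<forall>Y\<in>Ob C. \<forall>f\<in>Hom C X Y.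
        amap Q (omap F X) (omap F Y) (amap F X Y f) = amap P X Y f)"

text \<open>An adjunction \<open>F \<stileturn> G\<close> between fibrations \<open>P : C \<rightarrow> B\<close> and \<open>Q : D \<rightarrow> B\<close>, over \<open>B\<close>: both functors
  commute with the projections, and the unit and counit are vertical. The functors are not
  required to preserve cartesian arrows.\<close>

definition is_adjunction_over ::
    "('b, 'k) category \<Rightarrow> ('o, 'm) category \<Rightarrow> ('o, 'm, 'b, 'k) cat_functor \<Rightarrow>
     ('p, 'n) category \<Rightarrow> ('p, 'n, 'b, 'k) cat_functor \<Rightarrow>
     ('o, 'm, 'p, 'n) cat_functor \<Rightarrow> ('p, 'n, 'o, 'm) cat_functor \<Rightarrow> bool" where
  "is_adjunction_over B C P D Q F G \<longleftrightarrow>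
     is_fibration C B P \<and> is_fibration D B Q \<and>
     is_functor_over C D P Q F \<and> is_functor_over D C Q P G \<and>
     (\<exists>\<eta> \<epsilon>. is_adjunction C D F G \<eta> \<epsilon> \<and>
        (\<forall>X\<in>Ob C. amap P X (omap G (omap F X)) (\<eta> X) = Ident B (omap P X)) \<and>
        (\<forall>Y\<in>Ob D. amap Q (omap F (omap G Y)) Y (\<epsilon> Y) = Ident B (omap Q Y)))"


section \<open>Commutative rings, modules and commutative algebras\<close>

text \<open>The type \<open>'u\<close> plays the role of the universe: the objects are the structures whose carriers are
  subsets of \<open>'u\<close>. Arrows are extensional functions, so that equality of arrows is equality on the
  carrier.\<close>

definition Cring_cat :: "('u ring, 'u \<Rightarrow> 'u) category" where
  "Cring_cat =
     \<lparr>Ob = {R. cring R},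
      Hom = (\<lambda>R S. ring_hom R S \<inter> extensional (carrier R)),
      Ident = (\<lambda>R. \<lambda>x\<in>carrier R. x),
      Comp = (\<lambda>R S T g f. compose (carrier R) g f)\<rparr>"

definition module_hom :: "'r ring \<Rightarrow> ('r, 'm) module \<Rightarrow> ('r, 'n) module \<Rightarrow> ('m \<Rightarrow> 'n) set" where
  "module_hom R M N =
     {h. h \<in> carrier M \<rightarrow> carrier N \<and>
         (\<forall>x\<in>carrier M. \<forall>y\<in>carrier M. h (x \<oplus>\<^bsub>M\<^esub> y) = h x \<oplus>\<^bsub>N\<^esub> h y) \<and>
         (\<forall>r\<in>carrier R. \<forall>x\<in>carrier M. h (r \<odot>\<^bsub>M\<^esub> x) = r \<odot>\<^bsub>N\<^esub> h x)}"

definition algebra_hom :: "'r ring \<Rightarrow> ('r, 'a) module \<Rightarrow> ('r, 'b) module \<Rightarrow> ('a \<Rightarrow> 'b) set" where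
  "algebra_hom R A B =
     {h. h \<in> ring_hom A B \<and>
         (\<forall>r\<in>carrier R. \<forall>x\<in>carrier A. h (r \<odot>\<^bsub>A\<^esub> x) = r \<odot>\<^bsub>B\<^esub> h x)}"

text \<open>Restriction of scalars along \<open>f\<close>, both for modules and for algebras (which share a record type).\<close>

definition restrict_scalars :: "('r \<Rightarrow> 'r) \<Rightarrow> ('r, 'm) module \<Rightarrow> ('r, 'm) module" where
  "restrict_scalars f N = N\<lparr>smult := (\<lambda>r x. f r \<odot>\<^bsub>N\<^esub> x)\<rparr>"

text \<open>The library's module records contain the fields \<open>mult\<close> and \<open>one\<close>, which have no meaning for a
  module. The underlying module of an algebra has them erased, and so do all objects of \<open>Mod_cat\<close>.\<close>

definition underlying_module :: "('r, 'a) module \<Rightarrow> ('r, 'a) module" where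
  "underlying_module A = A\<lparr>mult := undefined, one := undefined\<rparr>"

definition Mod_cat :: "('u ring \<times> ('u, 'u) module, ('u \<Rightarrow> 'u) \<times> ('u \<Rightarrow> 'u)) category" where
  "Mod_cat =
     \<lparr>Ob = {(R, M). Module.module R M \<and> underlying_module M = M},
      Hom = (\<lambda>(R, M) (S, N). {(f, \<rho>).
               f \<in> Hom Cring_cat R S \<and>
               \<rho> \<in> module_hom R M (restrict_scalars f N) \<inter> extensional (carrier M)}),
      Ident = (\<lambda>(R, M). (\<lambda>x\<in>carrier R. x, \<lambda>x\<in>carrier M. x)),
      Comp = (\<lambda>(R, M) (S, N) (T, K) (g, \<phi>) (f, \<rho>).
               (compose (carrier R) g f, compose (carrier M) \<phi> \<rho>))\<rparr>"

definition CAlg_cat :: "('u ring \<times> ('u, 'u) module, ('u \<Rightarrow> 'u) \<times> ('u \<Rightarrow> 'u)) category" where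
  "CAlg_cat =
     \<lparr>Ob = {(R, A). algebra R A},
      Hom = (\<lambda>(R, A) (S, B). {(f, \<rho>).
               f \<in> Hom Cring_cat R S \<and>
               \<rho> \<in> algebra_hom R A (restrict_scalars f B) \<inter> extensional (carrier A)}),
      Ident = (\<lambda>(R, A). (\<lambda>x\<in>carrier R. x, \<lambda>x\<in>carrier A. x)),
      Comp = (\<lambda>(R, A) (S, B) (T, C) (g, \<phi>) (f, \<rho>).
               (compose (carrier R) g f, compose (carrier A) \<phi> \<rho>))\<rparr>"

definition proj_base ::
    "('u ring \<times> ('u, 'u) module, ('u \<Rightarrow> 'u) \<times> ('u \<Rightarrow> 'u), 'u ring, 'u \<Rightarrow> 'u) cat_functor" where
  "proj_base = \<lparr>omap = fst, amap = (\<lambda>X Y. fst)\<rparr>"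


section \<open>The symmetric algebra\<close>

text \<open>The polynomial ring over \<open>R\<close> in a set \<open>V\<close> of commuting variables: monomials are finite multisets
  over \<open>V\<close>, and a polynomial is its function of coefficients.\<close>

definition mpoly_ring :: "'r ring \<Rightarrow> 'v set \<Rightarrow> ('v multiset \<Rightarrow> 'r) ring" where
  "mpoly_ring R V =
     \<lparr>carrier = {p. (\<forall>m. p m \<in> carrier R) \<and> finite {m. p m \<noteq> \<zero>\<^bsub>R\<^esub>} \<and>
                    (\<forall>m. p m \<noteq> \<zero>\<^bsub>R\<^esub> \<longrightarrow> set_mset m \<subseteq> V)},
      mult = (\<lambda>p q m. \<Oplus>\<^bsub>R\<^esub>a\<in>{a. a \<subseteq># m}. p a \<otimes>\<^bsub>R\<^esub> q (m - a)),
      one = (\<lambda>m. if m = {#} then \<one>\<^bsub>R\<^esub> else \<zero>\<^bsub>R\<^esub>),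
      zero = (\<lambda>m. \<zero>\<^bsub>R\<^esub>),
      add = (\<lambda>p q m. p m \<oplus>\<^bsub>R\<^esub> q m)\<rparr>"

definition mpoly_const :: "'r ring \<Rightarrow> 'r \<Rightarrow> ('v multiset \<Rightarrow> 'r)" where
  "mpoly_const R r = (\<lambda>m. if m = {#} then r else \<zero>\<^bsub>R\<^esub>)"

definition mpoly_var :: "'r ring \<Rightarrow> 'v \<Rightarrow> ('v multiset \<Rightarrow> 'r)" where
  "mpoly_var R v = (\<lambda>m. if m = {#v#} then \<one>\<^bsub>R\<^esub> else \<zero>\<^bsub>R\<^esub>)"

text \<open>The symmetric algebra of \<open>M\<close> is \<open>R[X\<^sub>x | x \<in> M]\<close> modulo the ideal making \<open>x \<mapsto> X\<^sub>x\<close> an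
  \<open>R\<close>-linear map.\<close>

definition sym_ideal :: "'r ring \<Rightarrow> ('r, 'm) module \<Rightarrow> ('m multiset \<Rightarrow> 'r) set" where
  "sym_ideal R M =
     (let P = mpoly_ring R (carrier M); X = mpoly_var R; c = mpoly_const R in
      Idl\<^bsub>P\<^esub>
        ({X (x \<oplus>\<^bsub>M\<^esub> y) \<ominus>\<^bsub>P\<^esub> (X x \<oplus>\<^bsub>P\<^esub> X y) | x y. x \<in> carrier M \<and> y \<in> carrier M} \<union>
         {X (r \<odot>\<^bsub>M\<^esub> x) \<ominus>\<^bsub>P\<^esub> (c r \<otimes>\<^bsub>P\<^esub> X x) | r x. r \<in> carrier R \<and> x \<in> carrier M}))"

definition sym_alg_cosets :: "'r ring \<Rightarrow> ('r, 'm) module \<Rightarrow> ('r, ('m multiset \<Rightarrow> 'r) set) module" where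
  "sym_alg_cosets R M =
     (let P = mpoly_ring R (carrier M); I = sym_ideal R M; Q = P Quot I in
      \<lparr>carrier = carrier Q, mult = mult Q, one = one Q, zero = zero Q, add = add Q,
       smult = (\<lambda>r x. (I +>\<^bsub>P\<^esub> mpoly_const R r) \<otimes>\<^bsub>Q\<^esub> x)\<rparr>)"

text \<open>When \<open>'u\<close> is infinite, the symmetric algebra of a module over \<open>'u\<close> has at most as many elements
  as \<open>'u\<close>, so it has an isomorphic copy with carrier in \<open>'u\<close>; one such copy is chosen.\<close>

definition transport :: "('a \<Rightarrow> 'b) \<Rightarrow> ('r, 'a) module \<Rightarrow> ('r, 'b) module" where
  "transport j A =
     (let k = inv_into (carrier A) j in
      \<lparr>carrier = j ` carrier A,
       mult = (\<lambda>x y. j (k x \<otimes>\<^bsub>A\<^esub> k y)),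
       one = j \<one>\<^bsub>A\<^esub>,
       zero = j \<zero>\<^bsub>A\<^esub>,
       add = (\<lambda>x y. j (k x \<oplus>\<^bsub>A\<^esub> k y)),
       smult = (\<lambda>r x. j (r \<odot>\<^bsub>A\<^esub> k x))\<rparr>)"

definition sym_emb :: "'u ring \<Rightarrow> ('u, 'u) module \<Rightarrow> ('u multiset \<Rightarrow> 'u) set \<Rightarrow> 'u" where
  "sym_emb R M = (SOME j. inj_on j (carrier (sym_alg_cosets R M)))"

lemma infinite_list_inj: "\<exists>j :: 'u::infinite list \<Rightarrow> 'u. inj j"
proof -
  have inf: "infinite (UNIV :: 'u set)" by (rule infinite_UNIV)
  have len: "(card_of ({xs :: 'u list. length xs = n}), card_of (UNIV :: 'u set)) \<in> ordLeq" for n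
  proof (induction n)
    case 0
    have "inj_on (\<lambda>xs. undefined :: 'u) {xs :: 'u list. length xs = 0}" by (auto simp: inj_on_def)
    then show ?case using card_of_ordLeq by blast
  next
    case (Suc n)
    have eq: "{xs :: 'u list. length xs = Suc n} = (\<lambda>(x, xs). x # xs) ` (UNIV \<times> {xs. length xs = n})"
      (is "?A = _ ` ?B")
    proof (rule equalityI; rule subsetI)
      fix xs :: "'u list" assume "xs \<in> ?A"
      then have "xs = (\<lambda>(x, xs). x # xs) (hd xs, tl xs)" "(hd xs, tl xs) \<in> ?B"
        by (cases xs; simp)+
      then show "xs \<in> (\<lambda>(x, xs). x # xs) ` ?B" by (rule image_eqI)
    next
      fix xs :: "'u list" assume "xs \<in> (\<lambda>(x, xs). x # xs) ` ?B"
      then show "xs \<in> ?A" by auto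
    qed
    have "(card_of ?A, card_of ?B) \<in> ordLeq"
      unfolding eq by (rule card_of_image)
    also have "(card_of ((UNIV :: 'u set) \<times> {xs :: 'u list. length xs = n}), card_of ((UNIV :: 'u set) \<times> (UNIV :: 'u set))) \<in> ordLeq"
      by (rule card_of_Times_mono2[OF Suc])
    also have "(card_of ((UNIV :: 'u set) \<times> (UNIV :: 'u set)), card_of (UNIV :: 'u set)) \<in> ordLeq"
      by (rule ordIso_imp_ordLeq[OF card_of_Times_same_infinite[OF inf]])
    finally show ?case .
  qed
  have "(card_of (UNIV :: nat set), card_of (UNIV :: 'u set)) \<in> ordLeq"
    using inf by (simp only: infinite_iff_card_of_nat)
  then have "(card_of (\<Union>n::nat. {xs :: 'u list. length xs = n}), card_of (UNIV :: 'u set)) \<in> ordLeq"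
    by (rule card_of_UNION_ordLeq_infinite[OF inf]) (simp add: len)
  moreover have "(\<Union>n::nat. {xs :: 'u list. length xs = n}) = UNIV" by auto
  ultimately have "(card_of (UNIV :: 'u list set), card_of (UNIV :: 'u set)) \<in> ordLeq" by simp
  then show ?thesis using card_of_ordLeq[of "UNIV :: 'u list set" "UNIV :: 'u set"] by auto
qed

lemma sym_emb_inj:
  fixes R :: "'u::infinite ring"
  shows "inj_on (sym_emb R M) (carrier (sym_alg_cosets R M))"
proof -
  define P where "P = mpoly_ring R (carrier M)"
  obtain j :: "'u list \<Rightarrow> 'u" where j: "inj j" using infinite_list_inj by blast
  define ml :: "'u multiset \<Rightarrow> 'u list" where "ml = (\<lambda>m. SOME xs. mset xs = m)"
  have ml: "mset (ml m) = m" for m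
    unfolding ml_def by (rule someI_ex) (rule ex_mset)
  define e where "e = (\<lambda>(m, r). j (r # ml m))"
  have e: "inj e"
  proof (rule injI)
    fix x y assume "e x = e y"
    then have "snd x # ml (fst x) = snd y # ml (fst y)"
      by (intro injD[OF j]) (simp add: e_def case_prod_beta)
    then have "snd x = snd y" "mset (ml (fst x)) = mset (ml (fst y))" by auto
    then show "x = y" by (simp add: ml prod_eq_iff)
  qed
  define supp where "supp = (\<lambda>p :: 'u multiset \<Rightarrow> 'u. {(m, r). r = p m \<and> p m \<noteq> \<zero>\<^bsub>R\<^esub>})"
  define enc where "enc = (\<lambda>p. j (SOME xs. set xs = e ` supp p))"
  have fin: "finite (supp p)" if "p \<in> carrier P" for p
  proof -
    have "supp p = (\<lambda>m. (m, p m)) ` {m. p m \<noteq> \<zero>\<^bsub>R\<^esub>}"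
      unfolding supp_def by blast
    then show ?thesis using that by (simp add: P_def mpoly_ring_def)
  qed
  have enc: "set (SOME xs. set xs = e ` supp p) = e ` supp p" if "p \<in> carrier P" for p
    by (rule someI_ex[OF finite_list[OF finite_imageI[OF fin[OF that]]]])
  have inj: "inj_on enc (carrier P)"
  proof (rule inj_onI)
    fix p q assume pq: "p \<in> carrier P" "q \<in> carrier P" "enc p = enc q"
    have "j (SOME xs. set xs = e ` supp p) = j (SOME xs. set xs = e ` supp q)"
      using pq(3) unfolding enc_def .
    then have "set (SOME xs. set xs = e ` supp p) = set (SOME xs. set xs = e ` supp q)"
      by (rule arg_cong[OF injD[OF j]])
    then have "e ` supp p = e ` supp q"
      unfolding enc[OF pq(1)] enc[OF pq(2)] .
    then have supp_eq: "supp p = supp q" by (simp only: inj_image_eq_iff[OF e])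
    show "p = q"
    proof
      fix m show "p m = q m"
      proof (rule ccontr)
        assume ne: "p m \<noteq> q m"
        then have "p m \<noteq> \<zero>\<^bsub>R\<^esub> \<or> q m \<noteq> \<zero>\<^bsub>R\<^esub>" by auto
        then have "(m, p m) \<in> supp p \<or> (m, q m) \<in> supp q" by (simp add: supp_def)
        then have "(m, p m) \<in> supp q \<or> (m, q m) \<in> supp p" unfolding supp_eq .
        with ne show False by (simp add: supp_def)
      qed
    qed
  qed
  have car: "carrier (sym_alg_cosets R M) = (\<lambda>p. sym_ideal R M +>\<^bsub>P\<^esub> p) ` carrier P"
    by (simp add: sym_alg_cosets_def P_def Let_def FactRing_def A_RCOSETS_def' UNION_singleton_eq_range)
  define k where "k = inv_into (carrier P) (\<lambda>p. sym_ideal R M +>\<^bsub>P\<^esub> p)"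
  have k: "inj_on k (carrier (sym_alg_cosets R M))" "k ` carrier (sym_alg_cosets R M) \<subseteq> carrier P"
    unfolding k_def car by (rule inj_on_inv_into[OF subset_refl]) (simp add: image_subset_iff inv_into_into)
  have "inj_on (enc \<circ> k) (carrier (sym_alg_cosets R M))"
    by (rule comp_inj_on[OF k(1) inj_on_subset[OF inj k(2)]])
  then have "\<exists>i :: _ \<Rightarrow> 'u. inj_on i (carrier (sym_alg_cosets R M))" by blast
  then show ?thesis
    unfolding sym_emb_def by (rule someI_ex)
qed

definition sym_alg :: "'u ring \<Rightarrow> ('u, 'u) module \<Rightarrow> ('u, 'u) module" where
  "sym_alg R M = transport (sym_emb R M) (sym_alg_cosets R M)"

definition sym_gen :: "'u ring \<Rightarrow> ('u, 'u) module \<Rightarrow> 'u \<Rightarrow> 'u" where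
  "sym_gen R M x =
     sym_emb R M (sym_ideal R M +>\<^bsub>mpoly_ring R (carrier M)\<^esub> mpoly_var R x)"


section \<open>The functors\<close>

definition Und_functor :: "('u ring \<times> ('u, 'u) module, ('u \<Rightarrow> 'u) \<times> ('u \<Rightarrow> 'u),
    'u ring \<times> ('u, 'u) module, ('u \<Rightarrow> 'u) \<times> ('u \<Rightarrow> 'u)) cat_functor" where
  "Und_functor = \<lparr>omap = (\<lambda>(R, A). (R, underlying_module A)), amap = (\<lambda>X Y f. f)\<rparr>"

text \<open>On an arrow \<open>(f, \<rho>)\<close>, the functor \<open>Sym_functor\<close> gives the unique algebra map along \<open>f\<close> that extends \<open>\<rho>\<close>
  on the generators.\<close>

definition Sym_functor :: "('u ring \<times> ('u, 'u) module, ('u \<Rightarrow> 'u) \<times> ('u \<Rightarrow> 'u),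
    'u ring \<times> ('u, 'u) module, ('u \<Rightarrow> 'u) \<times> ('u \<Rightarrow> 'u)) cat_functor" where
  "Sym_functor =
     \<lparr>omap = (\<lambda>(S, M). (S, sym_alg S M)),
      amap = (\<lambda>(R, M) (S, N) (f, \<rho>).
        (f, THE \<phi>. \<phi> \<in> algebra_hom R (sym_alg R M) (restrict_scalars f (sym_alg S N)) \<and>
                   \<phi> \<in> extensional (carrier (sym_alg R M)) \<and>
                   (\<forall>x\<in>carrier M. \<phi> (sym_gen R M x) = sym_gen S N (\<rho> x))))\<rparr>"

end

theory Submission
  imports Defs
begin

text \<open>
  The adjunction is the universal property of the symmetric algebra, read over a varying base ring.
  For an \<open>R\<close>-module \<open>M\<close> and a commutative \<open>R\<close>-algebra \<open>B\<close>, every \<open>R\<close>-linear map \<open>M \<rightarrow> B\<close> extends uniquely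
  along \<open>M \<rightarrow> Sym\<^sub>R(M)\<close> to an \<open>R\<close>-algebra map. Base change costs nothing: a map from \<open>(R, M)\<close> to \<open>(S, B)\<close>
  over \<open>f : R \<rightarrow> S\<close> is by definition a map over \<open>R\<close> into the restriction of scalars of \<open>B\<close> along \<open>f\<close>, and
  that restriction is again an \<open>R\<close>-algebra. So \<open>(id, M \<rightarrow> Sym\<^sub>R(M))\<close> is a universal arrow from \<open>(R, M)\<close>
  to the functor \<open>Und\<close> on all of the total category (\<open>sym_universal_arrows\<close>), and a choice of
  universal arrows that is natural for the given action of \<open>Sym\<close> on arrows makes \<open>Sym\<close> a functor and
  a left adjoint (locale \<open>universal_arrows\<close>). The unit is vertical by construction. The counit is
  then vertical as well, since the triangle identity at \<open>(R, A)\<close> projects to \<open>g \<circ> id = id\<close> in the base,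
  where \<open>g\<close> is the ring component of the counit.

  The algebraic content is therefore the universal property. The symmetric algebra is the image of a
  polynomial ring \<open>P\<close> with one variable per element of \<open>M\<close>; a linear map \<open>\<rho>\<close> gives an evaluation
  homomorphism \<open>P \<rightarrow> B\<close>, which kills the defining relations and so factors
  (\<open>sym_alg_hom_exists\<close>); it is the only extension because the variables generate \<open>P\<close> as an algebra
  (\<open>sym_alg_hom_unique\<close>). That \<open>P\<close> is a commutative ring and that evaluation is multiplicative are both
  checked on monomials and spread by additivity (\<open>mpoly_induct\<close>).

  Both projections are fibrations for the same reason: restriction of scalars together with the
  identity map of the underlying set is a cartesian lift. The locale \<open>scalar_fibration\<close> treats modules
  and algebras at once, as structures whose arrows are functions compatible with the scalars.
\<close>

section \<open>Polynomials over a commutative ring\<close>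

locale mpoly = cring R for R :: "'a ring" (structure) +
  fixes V :: "'v set"
begin

abbreviation P :: "('v multiset \<Rightarrow> 'a) ring" where
  "P \<equiv> mpoly_ring R V"

definition monomial :: "'a \<Rightarrow> 'v multiset \<Rightarrow> 'v multiset \<Rightarrow> 'a" where
  "monomial c m = (\<lambda>k. if k = m then c else \<zero>)"

abbreviation supp :: "('v multiset \<Rightarrow> 'a) \<Rightarrow> 'v multiset set" where
  "supp p \<equiv> {m. p m \<noteq> \<zero>}"

lemma mpoly_carrier_iff:
  "p \<in> carrier P \<longleftrightarrow> (\<forall>m. p m \<in> carrier R) \<and> finite (supp p) \<and> (\<forall>m. p m \<noteq> \<zero> \<longrightarrow> set_mset m \<subseteq> V)"
  unfolding mpoly_ring_def by simp

lemma coeff_closed [simp]: "p \<in> carrier P \<Longrightarrow> p m \<in> carrier R"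
  by (simp add: mpoly_carrier_iff)

lemma finite_supp: "p \<in> carrier P \<Longrightarrow> finite (supp p)"
  by (simp add: mpoly_carrier_iff)

lemma mpoly_add: "p \<oplus>\<^bsub>P\<^esub> q = (\<lambda>m. p m \<oplus> q m)"
  unfolding mpoly_ring_def by simp

lemma mpoly_zero: "\<zero>\<^bsub>P\<^esub> = (\<lambda>m. \<zero>)"
  unfolding mpoly_ring_def by simp

lemma mpoly_one: "\<one>\<^bsub>P\<^esub> = monomial \<one> {#}"
  unfolding mpoly_ring_def monomial_def by simp

lemma mpoly_mult: "p \<otimes>\<^bsub>P\<^esub> q = (\<lambda>m. \<Oplus>a\<in>{a. a \<subseteq># m}. p a \<otimes> q (m - a))"
  unfolding mpoly_ring_def by simp

lemma mpoly_const_eq: "mpoly_const R r = monomial r {#}"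
  by (simp add: mpoly_const_def monomial_def)

lemma mpoly_var_eq: "mpoly_var R v = monomial \<one> {#v#}"
  by (simp add: mpoly_var_def monomial_def)

lemma finite_submultisets: "finite {a. a \<subseteq># (m :: 'v multiset)}"
proof -
  have "{a. a \<subseteq># m} \<subseteq> (\<lambda>xs. mset xs) ` {xs. set xs \<subseteq> set_mset m \<and> length xs \<le> size m}"
  proof
    fix a assume "a \<in> {a. a \<subseteq># m}"
    then have sub: "a \<subseteq># m" by simp
    obtain xs where "mset xs = a" using ex_mset by blast
    moreover from this sub have "set xs \<subseteq> set_mset m" "length xs \<le> size m"
      using size_mset_mono set_mset_mono by fastforce+
    ultimately show "a \<in> (\<lambda>xs. mset xs) ` {xs. set xs \<subseteq> set_mset m \<and> length xs \<le> size m}" by blast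
  qed
  moreover have "finite {xs. set xs \<subseteq> set_mset m \<and> length xs \<le> size m}"
    by (intro finite_lists_length_le) simp
  ultimately show ?thesis by (meson finite_imageI finite_subset)
qed

lemma monomial_closed: "c \<in> carrier R \<Longrightarrow> set_mset m \<subseteq> V \<Longrightarrow> monomial c m \<in> carrier P"
  unfolding mpoly_carrier_iff monomial_def by auto

lemma monomial_add:
  "c \<in> carrier R \<Longrightarrow> d \<in> carrier R \<Longrightarrow> monomial c m \<oplus>\<^bsub>P\<^esub> monomial d m = monomial (c \<oplus> d) m"
  by (auto simp: mpoly_add monomial_def)

lemma mpoly_abelian_group: "abelian_group P"
proof (rule abelian_groupI)
  fix p q assume pq: "p \<in> carrier P" "q \<in> carrier P"
  have "supp (p \<oplus>\<^bsub>P\<^esub> q) \<subseteq> supp p \<union> supp q" using pq by (auto simp: mpoly_add)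
  then have "finite (supp (p \<oplus>\<^bsub>P\<^esub> q))"
    by (rule finite_subset) (use pq in \<open>simp add: finite_supp\<close>)
  then show "p \<oplus>\<^bsub>P\<^esub> q \<in> carrier P"
    using pq unfolding mpoly_carrier_iff mpoly_add by (metis add.m_closed l_zero zero_closed)
  show "p \<oplus>\<^bsub>P\<^esub> q = q \<oplus>\<^bsub>P\<^esub> p" using pq by (simp add: mpoly_add a_comm)
next
  fix p assume p: "p \<in> carrier P"
  have neg: "\<ominus> p m = \<zero> \<longleftrightarrow> p m = \<zero>" for m
    using coeff_closed[OF p] by (metis minus_minus minus_zero)
  then have "(\<lambda>m. \<ominus> p m) \<in> carrier P"
    using p unfolding mpoly_carrier_iff by simp
  then show "\<exists>q\<in>carrier P. q \<oplus>\<^bsub>P\<^esub> p = \<zero>\<^bsub>P\<^esub>"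
    using p by (intro bexI) (simp_all add: mpoly_add mpoly_zero l_neg)
qed (auto simp: mpoly_add mpoly_zero mpoly_carrier_iff a_assoc)

text \<open>A monomial of the product is a sum of a monomial of each factor, so the support of the product
  lies in the image of a finite set.\<close>

lemma mpoly_mult_closed:
  assumes p: "p \<in> carrier P" and q: "q \<in> carrier P"
  shows "p \<otimes>\<^bsub>P\<^esub> q \<in> carrier P"
proof -
  have nz: "\<exists>a b. a + b = m \<and> p a \<noteq> \<zero> \<and> q b \<noteq> \<zero>" if "(p \<otimes>\<^bsub>P\<^esub> q) m \<noteq> \<zero>" for m
  proof (rule ccontr)
    assume neg: "\<not> ?thesis"
    have "p a \<otimes> q (m - a) = \<zero>" if "a \<subseteq># m" for a
    proof -
      have "p a = \<zero> \<or> q (m - a) = \<zero>" using neg that by (metis subset_mset.add_diff_inverse)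
      then show ?thesis using p q by auto
    qed
    then have "(p \<otimes>\<^bsub>P\<^esub> q) m = \<zero>"
      unfolding mpoly_mult by (intro add.finprod_one_eqI) simp
    with that show False by simp
  qed
  then have "supp (p \<otimes>\<^bsub>P\<^esub> q) \<subseteq> (\<lambda>(a, b). a + b) ` (supp p \<times> supp q)" by force
  then have "finite (supp (p \<otimes>\<^bsub>P\<^esub> q))"
    by (rule finite_subset) (use p q in \<open>simp add: finite_supp\<close>)
  moreover have "(p \<otimes>\<^bsub>P\<^esub> q) m \<in> carrier R" for m
    unfolding mpoly_mult using p q by (intro finsum_closed) auto
  moreover have "set_mset m \<subseteq> V" if "(p \<otimes>\<^bsub>P\<^esub> q) m \<noteq> \<zero>" for m
    using nz[OF that] p q unfolding mpoly_carrier_iff by fastforce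
  ultimately show ?thesis unfolding mpoly_carrier_iff by blast
qed

lemma mpoly_l_distr:
  assumes "p \<in> carrier P" "q \<in> carrier P" "r \<in> carrier P"
  shows "(p \<oplus>\<^bsub>P\<^esub> q) \<otimes>\<^bsub>P\<^esub> r = p \<otimes>\<^bsub>P\<^esub> r \<oplus>\<^bsub>P\<^esub> q \<otimes>\<^bsub>P\<^esub> r"
proof
  fix m
  have "(\<Oplus>a\<in>{a. a \<subseteq># m}. (p a \<oplus> q a) \<otimes> r (m - a)) =
        (\<Oplus>a\<in>{a. a \<subseteq># m}. p a \<otimes> r (m - a) \<oplus> q a \<otimes> r (m - a))"
    by (rule finsum_cong') (use assms in \<open>auto simp: l_distr\<close>)
  also have "\<dots> = (\<Oplus>a\<in>{a. a \<subseteq># m}. p a \<otimes> r (m - a)) \<oplus> (\<Oplus>a\<in>{a. a \<subseteq># m}. q a \<otimes> r (m - a))"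
    by (rule finsum_addf) (use assms in auto)
  finally show "((p \<oplus>\<^bsub>P\<^esub> q) \<otimes>\<^bsub>P\<^esub> r) m = (p \<otimes>\<^bsub>P\<^esub> r \<oplus>\<^bsub>P\<^esub> q \<otimes>\<^bsub>P\<^esub> r) m"
    by (simp add: mpoly_mult mpoly_add)
qed

text \<open>The involution \<open>a \<mapsto> m - a\<close> on the submultisets of \<open>m\<close> exchanges the two convolution sums.\<close>

lemma mpoly_m_comm:
  assumes "p \<in> carrier P" "q \<in> carrier P"
  shows "p \<otimes>\<^bsub>P\<^esub> q = q \<otimes>\<^bsub>P\<^esub> p"
proof
  fix m :: "'v multiset"
  have inv: "m - (m - a) = a" if "a \<subseteq># m" for a
    using that by (auto simp: subset_mset.le_iff_add)
  then have inj: "inj_on (\<lambda>a. m - a) {a. a \<subseteq># m}"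
    by (intro inj_on_inverseI) simp
  have im: "(\<lambda>a. m - a) ` {a. a \<subseteq># m} = {a. a \<subseteq># m}"
  proof (intro equalityI subsetI)
    fix a assume "a \<in> {a. a \<subseteq># m}"
    then have "a = m - (m - a)" "m - a \<in> {a. a \<subseteq># m}" by (simp_all add: inv)
    then show "a \<in> (\<lambda>a. m - a) ` {a. a \<subseteq># m}" by (rule image_eqI)
  qed auto
  have "(\<Oplus>a\<in>{a. a \<subseteq># m}. p a \<otimes> q (m - a)) = (\<Oplus>a\<in>(\<lambda>a. m - a) ` {a. a \<subseteq># m}. p a \<otimes> q (m - a))"
    unfolding im ..
  also have "\<dots> = (\<Oplus>a\<in>{a. a \<subseteq># m}. p (m - a) \<otimes> q (m - (m - a)))"
    by (rule finsum_reindex[OF _ inj]) (use assms in auto)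
  also have "\<dots> = (\<Oplus>a\<in>{a. a \<subseteq># m}. q a \<otimes> p (m - a))"
  proof (rule finsum_cong')
    fix a assume "a \<in> {a. a \<subseteq># m}"
    then have "m - (m - a) = a" by (simp add: inv)
    then show "p (m - a) \<otimes> q (m - (m - a)) = q a \<otimes> p (m - a)" using assms by (simp add: m_comm)
  qed (use assms in auto)
  finally show "(p \<otimes>\<^bsub>P\<^esub> q) m = (q \<otimes>\<^bsub>P\<^esub> p) m" by (simp add: mpoly_mult)
qed

text \<open>Multiplication by a single term only shifts the exponents. So a product with a term as
  left factor can be computed without the convolution sum.\<close>

lemma monomial_mult_coeff:
  assumes c: "c \<in> carrier R" and q: "q \<in> carrier P"
  shows "(monomial c m \<otimes>\<^bsub>P\<^esub> q) k = (if m \<subseteq># k then c \<otimes> q (k - m) else \<zero>)"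
proof (cases "m \<subseteq># k")
  case True
  have "(monomial c m \<otimes>\<^bsub>P\<^esub> q) k = (\<Oplus>a\<in>{a. a \<subseteq># k}. if m = a then c \<otimes> q (k - a) else \<zero>)"
    unfolding mpoly_mult by (rule finsum_cong') (use assms in \<open>auto simp: monomial_def\<close>)
  also have "\<dots> = c \<otimes> q (k - m)"
    by (rule finsum_singleton) (use True assms finite_submultisets in auto)
  finally show ?thesis using True by simp
next
  case False
  have "(monomial c m \<otimes>\<^bsub>P\<^esub> q) k = \<zero>"
    unfolding mpoly_mult
    by (rule add.finprod_one_eqI) (use False assms in \<open>auto simp: monomial_def\<close>)
  then show ?thesis using False by simp
qed

lemma monomial_mult:
  assumes "c \<in> carrier R" "d \<in> carrier R" "set_mset n \<subseteq> V"
  shows "monomial c m \<otimes>\<^bsub>P\<^esub> monomial d n = monomial (c \<otimes> d) (m + n)"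
proof
  fix k
  show "(monomial c m \<otimes>\<^bsub>P\<^esub> monomial d n) k = monomial (c \<otimes> d) (m + n) k"
    unfolding monomial_mult_coeff[OF assms(1) monomial_closed[OF assms(2,3)]]
    using assms by (auto simp: monomial_def subset_mset.le_iff_add)
qed

text \<open>A polynomial is a finite sum of terms. The product and evaluation are additive in each
  argument, so this induction reduces identities about them to identities between terms, and
  avoids rearranging nested sums over submultisets.\<close>

lemma mpoly_induct [consumes 1, case_names zero add]:
  assumes "p \<in> carrier P"
    and zero: "Q \<zero>\<^bsub>P\<^esub>"
    and add: "\<And>c m p. \<lbrakk>c \<in> carrier R; set_mset m \<subseteq> V; p \<in> carrier P; Q p\<rbrakk> \<Longrightarrow> Q (monomial c m \<oplus>\<^bsub>P\<^esub> p)"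
  shows "Q p"
  using assms(1)
proof (induction "card (supp p)" arbitrary: p)
  case 0
  then have "supp p = {}" using finite_supp[OF 0(2)] by simp
  then have "p = \<zero>\<^bsub>P\<^esub>" by (auto simp: mpoly_zero)
  then show ?case using zero by simp
next
  case (Suc n)
  then have "card (supp p) \<noteq> 0" by linarith
  then have "supp p \<noteq> {}" by (metis card.empty)
  then obtain m where m: "p m \<noteq> \<zero>" by blast
  define q where "q = p(m := \<zero>)"
  have sq: "supp q = supp p - {m}" by (auto simp: q_def)
  have "q \<in> carrier P"
    using Suc.prems unfolding mpoly_carrier_iff sq by (auto simp: q_def)
  moreover have "n = card (supp q)"
    unfolding sq using Suc.hyps(2) m finite_supp[OF Suc.prems] by simp
  ultimately have "Q (monomial (p m) m \<oplus>\<^bsub>P\<^esub> q)"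
    using Suc.hyps(1) Suc.prems m by (intro add) (auto simp: mpoly_carrier_iff)
  moreover have "monomial (p m) m \<oplus>\<^bsub>P\<^esub> q = p"
    using Suc.prems by (auto simp: mpoly_add monomial_def q_def)
  ultimately show ?case by simp
qed

lemma mpoly_r_distr:
  assumes "p \<in> carrier P" "q \<in> carrier P" "r \<in> carrier P"
  shows "p \<otimes>\<^bsub>P\<^esub> (q \<oplus>\<^bsub>P\<^esub> r) = p \<otimes>\<^bsub>P\<^esub> q \<oplus>\<^bsub>P\<^esub> p \<otimes>\<^bsub>P\<^esub> r"
proof -
  interpret P: abelian_group P by (rule mpoly_abelian_group)
  show ?thesis
    using assms mpoly_l_distr[of q r p] mpoly_m_comm[of p] by simp
qed

lemma mpoly_zero_mult:
  assumes "p \<in> carrier P" shows "\<zero>\<^bsub>P\<^esub> \<otimes>\<^bsub>P\<^esub> p = \<zero>\<^bsub>P\<^esub>"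
  using assms by (auto simp: mpoly_zero mpoly_mult intro: add.finprod_one_eqI)

text \<open>Both sides are additive in \<open>p\<close> and in \<open>q\<close>, so these may be taken to be terms; then associativity is
  the equivalence of \<open>k + l \<subseteq> m\<close> with \<open>k \<subseteq> m\<close> and \<open>l \<subseteq> m - k\<close>. The factor \<open>r\<close> can stay arbitrary.\<close>

lemma mpoly_m_assoc:
  assumes "p \<in> carrier P" "q \<in> carrier P" "r \<in> carrier P"
  shows "(p \<otimes>\<^bsub>P\<^esub> q) \<otimes>\<^bsub>P\<^esub> r = p \<otimes>\<^bsub>P\<^esub> (q \<otimes>\<^bsub>P\<^esub> r)"
proof -
  interpret P: abelian_group P by (rule mpoly_abelian_group)
  note closed = monomial_closed mpoly_mult_closed
  have 1: "(monomial c k \<otimes>\<^bsub>P\<^esub> monomial d l) \<otimes>\<^bsub>P\<^esub> r = monomial c k \<otimes>\<^bsub>P\<^esub> (monomial d l \<otimes>\<^bsub>P\<^esub> r)"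
    if "c \<in> carrier R" "set_mset k \<subseteq> V" "d \<in> carrier R" "set_mset l \<subseteq> V" for c k d l
  proof
    fix m
    have "k + l \<subseteq># m \<longleftrightarrow> k \<subseteq># m \<and> l \<subseteq># m - k"
      using subset_mset.le_diff_conv2[of k m l] subset_mset.order_trans[of k "k + l" m]
      by (auto simp: add.commute)
    then show "((monomial c k \<otimes>\<^bsub>P\<^esub> monomial d l) \<otimes>\<^bsub>P\<^esub> r) m = (monomial c k \<otimes>\<^bsub>P\<^esub> (monomial d l \<otimes>\<^bsub>P\<^esub> r)) m"
      using that assms by (auto simp: monomial_mult monomial_mult_coeff closed m_assoc)
  qed
  have 2: "(monomial c k \<otimes>\<^bsub>P\<^esub> q) \<otimes>\<^bsub>P\<^esub> r = monomial c k \<otimes>\<^bsub>P\<^esub> (q \<otimes>\<^bsub>P\<^esub> r)"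
    if "c \<in> carrier R" "set_mset k \<subseteq> V" for c k
    using assms(2)
  proof (induction q rule: mpoly_induct)
    case zero
    then show ?case using that assms
      by (simp add: mpoly_zero_mult mpoly_m_comm[of "monomial c k" "\<zero>\<^bsub>P\<^esub>"] closed)
  next
    case (add d l q)
    then show ?case using that assms
      by (simp add: mpoly_l_distr mpoly_r_distr closed 1)
  qed
  show ?thesis using assms(1)
  proof (induction p rule: mpoly_induct)
    case zero
    then show ?case using assms by (simp add: mpoly_zero_mult closed)
  next
    case (add c k p)
    then show ?case using assms by (simp add: mpoly_l_distr closed 2)
  qed
qed

lemma mpoly_cring: "cring P"
proof (rule cringI)
  show "comm_monoid P"
  proof (rule comm_monoidI)
    show "\<one>\<^bsub>P\<^esub> \<in> carrier P" by (simp add: mpoly_one monomial_closed)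
    show "\<one>\<^bsub>P\<^esub> \<otimes>\<^bsub>P\<^esub> p = p" if "p \<in> carrier P" for p
      using that by (intro ext) (simp add: mpoly_one monomial_mult_coeff)
  qed (fact mpoly_mult_closed mpoly_m_assoc mpoly_m_comm)+
qed (fact mpoly_abelian_group mpoly_l_distr)+

end

section \<open>Evaluation of polynomials in an algebra\<close>

locale mpoly_eval = mpoly R V + B: algebra R B
  for R :: "'a ring" (structure) and V :: "'v set" and B :: "('a, 'c) module" +
  fixes \<rho> :: "'v \<Rightarrow> 'c"
  assumes gen_closed: "v \<in> V \<Longrightarrow> \<rho> v \<in> carrier B"
begin

text \<open>The value of the monomial \<open>m\<close>, that is, the product of \<open>\<rho> v\<close> over the multiset \<open>m\<close>. Written
  with powers over the underlying set, it turns sums of multisets into products by adding exponents.\<close>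

definition mon_eval :: "'v multiset \<Rightarrow> 'c" where
  "mon_eval m = finprod B (\<lambda>v. \<rho> v [^]\<^bsub>B\<^esub> count m v) (set_mset m)"

definition eval :: "('v multiset \<Rightarrow> 'a) \<Rightarrow> 'c" where
  "eval p = (\<Oplus>\<^bsub>B\<^esub>m\<in>supp p. p m \<odot>\<^bsub>B\<^esub> mon_eval m)"

lemma mon_eval_closed: "set_mset m \<subseteq> V \<Longrightarrow> mon_eval m \<in> carrier B"
  unfolding mon_eval_def by (intro B.finprod_closed) (auto intro!: B.nat_pow_closed gen_closed)

lemma mon_eval_empty: "mon_eval {#} = \<one>\<^bsub>B\<^esub>"
  by (simp add: mon_eval_def)

lemma mon_eval_single: "v \<in> V \<Longrightarrow> mon_eval {#v#} = \<rho> v"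
  by (simp add: mon_eval_def gen_closed)

lemma mon_eval_superset:
  assumes "set_mset m \<subseteq> A" "A \<subseteq> V" "finite A"
  shows "mon_eval m = finprod B (\<lambda>v. \<rho> v [^]\<^bsub>B\<^esub> count m v) A"
  unfolding mon_eval_def
  by (rule B.finprod_mono_neutral_cong_left)
     (use assms in \<open>auto intro!: B.nat_pow_closed gen_closed simp: not_in_iff\<close>)

lemma mon_eval_union:
  assumes m: "set_mset m \<subseteq> V" and n: "set_mset n \<subseteq> V"
  shows "mon_eval (m + n) = mon_eval m \<otimes>\<^bsub>B\<^esub> mon_eval n"
proof -
  let ?A = "set_mset m \<union> set_mset n"
  have A: "v \<in> ?A \<Longrightarrow> \<rho> v \<in> carrier B" for v using m n gen_closed by auto
  have "mon_eval (m + n) = finprod B (\<lambda>v. \<rho> v [^]\<^bsub>B\<^esub> count (m + n) v) ?A"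
    by (rule mon_eval_superset) (use m n in auto)
  also have "\<dots> = finprod B (\<lambda>v. \<rho> v [^]\<^bsub>B\<^esub> count m v \<otimes>\<^bsub>B\<^esub> \<rho> v [^]\<^bsub>B\<^esub> count n v) ?A"
    by (rule B.finprod_cong') (use A in \<open>auto simp: B.nat_pow_mult\<close>)
  also have "\<dots> = finprod B (\<lambda>v. \<rho> v [^]\<^bsub>B\<^esub> count m v) ?A \<otimes>\<^bsub>B\<^esub> finprod B (\<lambda>v. \<rho> v [^]\<^bsub>B\<^esub> count n v) ?A"
    by (rule B.finprod_multf) (use A in auto)
  also have "\<dots> = mon_eval m \<otimes>\<^bsub>B\<^esub> mon_eval n"
    using mon_eval_superset[of m ?A] mon_eval_superset[of n ?A] m n by simp
  finally show ?thesis .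
qed

text \<open>Enlarging the index set by zero terms lets the supports of two polynomials be compared in \<open>eval_add\<close>.\<close>

lemma eval_superset:
  assumes p: "p \<in> carrier P" and A: "supp p \<subseteq> A" "finite A" "\<And>m. m \<in> A \<Longrightarrow> set_mset m \<subseteq> V"
  shows "eval p = (\<Oplus>\<^bsub>B\<^esub>m\<in>A. p m \<odot>\<^bsub>B\<^esub> mon_eval m)"
  unfolding eval_def
  by (rule B.add.finprod_mono_neutral_cong_left)
     (use assms in \<open>auto intro!: B.smult_closed mon_eval_closed B.smult_l_null\<close>)

lemma eval_closed: "p \<in> carrier P \<Longrightarrow> eval p \<in> carrier B"
  unfolding eval_def
  by (intro B.finsum_closed) (auto intro!: B.smult_closed mon_eval_closed simp: mpoly_carrier_iff)

lemma eval_monomial: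
  assumes "c \<in> carrier R" "set_mset m \<subseteq> V"
  shows "eval (monomial c m) = c \<odot>\<^bsub>B\<^esub> mon_eval m"
proof -
  have "eval (monomial c m) = (\<Oplus>\<^bsub>B\<^esub>k\<in>{m}. monomial c m k \<odot>\<^bsub>B\<^esub> mon_eval k)"
  proof (rule eval_superset)
    show "monomial c m \<in> carrier P" using assms by (rule monomial_closed)
  qed (use assms in \<open>auto simp: monomial_def split: if_splits\<close>)
  also have "\<dots> = c \<odot>\<^bsub>B\<^esub> mon_eval m"
    using assms mon_eval_closed by (simp add: monomial_def)
  finally show ?thesis .
qed

lemma eval_add:
  assumes p: "p \<in> carrier P" and q: "q \<in> carrier P"
  shows "eval (p \<oplus>\<^bsub>P\<^esub> q) = eval p \<oplus>\<^bsub>B\<^esub> eval q"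
proof -
  interpret P: cring P by (rule mpoly_cring)
  let ?A = "supp p \<union> supp q"
  have A: "finite ?A" "\<And>m. m \<in> ?A \<Longrightarrow> set_mset m \<subseteq> V"
    using p q by (auto simp: mpoly_carrier_iff)
  have "supp (p \<oplus>\<^bsub>P\<^esub> q) \<subseteq> ?A" using p q by (auto simp: mpoly_add)
  then have "eval (p \<oplus>\<^bsub>P\<^esub> q) = (\<Oplus>\<^bsub>B\<^esub>m\<in>?A. (p \<oplus>\<^bsub>P\<^esub> q) m \<odot>\<^bsub>B\<^esub> mon_eval m)"
    using p q A by (intro eval_superset) auto
  also have "\<dots> = (\<Oplus>\<^bsub>B\<^esub>m\<in>?A. p m \<odot>\<^bsub>B\<^esub> mon_eval m \<oplus>\<^bsub>B\<^esub> q m \<odot>\<^bsub>B\<^esub> mon_eval m)"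
    by (rule B.finsum_cong')
       (use p q A in \<open>auto simp: mpoly_add mon_eval_closed B.smult_l_distr\<close>)
  also have "\<dots> = (\<Oplus>\<^bsub>B\<^esub>m\<in>?A. p m \<odot>\<^bsub>B\<^esub> mon_eval m) \<oplus>\<^bsub>B\<^esub> (\<Oplus>\<^bsub>B\<^esub>m\<in>?A. q m \<odot>\<^bsub>B\<^esub> mon_eval m)"
    by (rule B.finsum_addf) (use p q A in \<open>auto simp: mon_eval_closed\<close>)
  also have "\<dots> = eval p \<oplus>\<^bsub>B\<^esub> eval q"
    using eval_superset[OF p _ A] eval_superset[OF q _ A] by simp
  finally show ?thesis .
qed

lemma eval_zero: "eval \<zero>\<^bsub>P\<^esub> = \<zero>\<^bsub>B\<^esub>"
  by (simp add: eval_def mpoly_zero)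

text \<open>Both sides are biadditive, so it suffices to compare them on terms, where \<open>mon_eval_union\<close> applies.\<close>

lemma eval_mult:
  assumes p: "p \<in> carrier P" and q: "q \<in> carrier P"
  shows "eval (p \<otimes>\<^bsub>P\<^esub> q) = eval p \<otimes>\<^bsub>B\<^esub> eval q"
proof -
  interpret P: cring P by (rule mpoly_cring)
  note closed = monomial_closed eval_closed mon_eval_closed
  have 1: "eval (monomial c k \<otimes>\<^bsub>P\<^esub> q) = eval (monomial c k) \<otimes>\<^bsub>B\<^esub> eval q"
    if ck: "c \<in> carrier R" "set_mset k \<subseteq> V" for c k
    using q
  proof (induction q rule: mpoly_induct)
    case zero
    then show ?case using ck by (simp add: eval_zero closed)
  next
    case (add d l q)
    have "eval (monomial c k \<otimes>\<^bsub>P\<^esub> monomial d l) = (c \<otimes> d) \<odot>\<^bsub>B\<^esub> (mon_eval k \<otimes>\<^bsub>B\<^esub> mon_eval l)"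
      using ck add.hyps by (simp add: monomial_mult eval_monomial mon_eval_union)
    also have "\<dots> = c \<odot>\<^bsub>B\<^esub> (mon_eval k \<otimes>\<^bsub>B\<^esub> (d \<odot>\<^bsub>B\<^esub> mon_eval l))"
      using ck add.hyps by (simp add: closed B.smult_assoc1 B.smult_assoc2 B.m_comm[of "mon_eval k"])
    also have "\<dots> = eval (monomial c k) \<otimes>\<^bsub>B\<^esub> eval (monomial d l)"
      using ck add.hyps by (simp add: closed eval_monomial B.smult_assoc2)
    finally show ?case
      using ck add by (simp add: P.r_distr B.r_distr closed eval_add)
  qed
  show ?thesis using p
  proof (induction p rule: mpoly_induct)
    case zero
    then show ?case using q by (simp add: eval_zero closed)
  next
    case (add c k p)
    then show ?case using q by (simp add: P.l_distr B.l_distr closed eval_add 1)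
  qed
qed

lemma eval_ring_hom: "eval \<in> ring_hom P B"
proof (rule ring_hom_memI)
  show "eval \<one>\<^bsub>P\<^esub> = \<one>\<^bsub>B\<^esub>"
    by (simp add: mpoly_one eval_monomial mon_eval_empty)
qed (simp_all add: eval_closed eval_mult eval_add)

lemma eval_var: "v \<in> V \<Longrightarrow> eval (mpoly_var R v) = \<rho> v"
  by (simp add: mpoly_var_eq eval_monomial mon_eval_single gen_closed)

lemma eval_const: "r \<in> carrier R \<Longrightarrow> eval (mpoly_const R r) = r \<odot>\<^bsub>B\<^esub> \<one>\<^bsub>B\<^esub>"
  by (simp add: mpoly_const_eq eval_monomial mon_eval_empty)

end

section \<open>The symmetric algebra of a module\<close>

text \<open>This transfers the ring axioms to the quotient of the polynomial ring and to its relabelled copy in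
  a single step. The condition on zero is separate because a ring homomorphism into a bare record does
  not have to respect the designated zero.\<close>

lemma (in cring) cring_surjective_image:
  assumes h: "h \<in> ring_hom R S" and zero: "h \<zero> = \<zero>\<^bsub>S\<^esub>" and surj: "h ` carrier R = carrier S"
  shows "cring S"
proof -
  \<comment> \<open>The image of a ring homomorphism, with its zero corrected, is all of \<open>S\<close>.\<close>
  have eq: "S\<lparr>carrier := h ` carrier R, zero := h \<zero>\<rparr> = S" by (simp add: zero surj)
  have "ring S" using ring_hom_imp_img_ring[OF h] unfolding eq .
  then interpret S: ring S .
  have "comm_monoid S"
  proof (rule S.monoid_comm_monoidI)
    fix x y assume "x \<in> carrier S" "y \<in> carrier S"
    then obtain a b where ab: "x = h a" "a \<in> carrier R" "y = h b" "b \<in> carrier R"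
      unfolding surj[symmetric] by blast
    then show "x \<otimes>\<^bsub>S\<^esub> y = y \<otimes>\<^bsub>S\<^esub> x"
      using ring_hom_mult[OF h, of a b] ring_hom_mult[OF h, of b a] by (simp add: m_comm)
  qed
  then show ?thesis using \<open>ring S\<close> by (rule cring.intro[rotated])
qed

lemma algebra_of_ring_hom:
  assumes R: "cring R" and A: "cring A" and h: "h \<in> ring_hom R A"
    and smult: "\<And>r x. \<lbrakk>r \<in> carrier R; x \<in> carrier A\<rbrakk> \<Longrightarrow> r \<odot>\<^bsub>A\<^esub> x = h r \<otimes>\<^bsub>A\<^esub> x"
  shows "algebra R A"
proof -
  interpret R: cring R by fact
  interpret A: cring A by fact
  note [simp] = ring_hom_closed[OF h] ring_hom_add[OF h] ring_hom_mult[OF h] ring_hom_one[OF h]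
  show ?thesis
    by (rule algebraI[OF R A]) (simp_all add: smult A.l_distr A.r_distr A.m_assoc)
qed

lemma module_homI:
  assumes "\<And>x. x \<in> carrier M \<Longrightarrow> h x \<in> carrier N"
    and "\<And>x y. \<lbrakk>x \<in> carrier M; y \<in> carrier M\<rbrakk> \<Longrightarrow> h (x \<oplus>\<^bsub>M\<^esub> y) = h x \<oplus>\<^bsub>N\<^esub> h y"
    and "\<And>r x. \<lbrakk>r \<in> carrier R; x \<in> carrier M\<rbrakk> \<Longrightarrow> h (r \<odot>\<^bsub>M\<^esub> x) = r \<odot>\<^bsub>N\<^esub> h x"
  shows "h \<in> module_hom R M N"
  using assms by (auto simp: module_hom_def)

lemma module_hom_memD:
  assumes "h \<in> module_hom R M N"
  shows "x \<in> carrier M \<Longrightarrow> h x \<in> carrier N"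
    and "\<lbrakk>x \<in> carrier M; y \<in> carrier M\<rbrakk> \<Longrightarrow> h (x \<oplus>\<^bsub>M\<^esub> y) = h x \<oplus>\<^bsub>N\<^esub> h y"
    and "\<lbrakk>r \<in> carrier R; x \<in> carrier M\<rbrakk> \<Longrightarrow> h (r \<odot>\<^bsub>M\<^esub> x) = r \<odot>\<^bsub>N\<^esub> h x"
  using assms by (auto simp: module_hom_def)

lemma algebra_hom_memD:
  assumes "h \<in> algebra_hom R A B"
  shows "h \<in> ring_hom A B"
    and "\<lbrakk>r \<in> carrier R; x \<in> carrier A\<rbrakk> \<Longrightarrow> h (r \<odot>\<^bsub>A\<^esub> x) = r \<odot>\<^bsub>B\<^esub> h x"
  using assms by (auto simp: algebra_hom_def)

locale sym_algebra = module R M + mpoly R "carrier M"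
  for R :: "'u::infinite ring" (structure) and M :: "('u, 'u) module"
begin

abbreviation I :: "('u multiset \<Rightarrow> 'u) set" where
  "I \<equiv> sym_ideal R M"

abbreviation var :: "'u \<Rightarrow> 'u multiset \<Rightarrow> 'u" where
  "var \<equiv> mpoly_var R"

abbreviation const :: "'u \<Rightarrow> 'u multiset \<Rightarrow> 'u" where
  "const \<equiv> mpoly_const R"

definition relations :: "('u multiset \<Rightarrow> 'u) set" where
  "relations =
     {var (x \<oplus>\<^bsub>M\<^esub> y) \<ominus>\<^bsub>P\<^esub> (var x \<oplus>\<^bsub>P\<^esub> var y) | x y. x \<in> carrier M \<and> y \<in> carrier M} \<union>
     {var (r \<odot>\<^bsub>M\<^esub> x) \<ominus>\<^bsub>P\<^esub> (const r \<otimes>\<^bsub>P\<^esub> var x) | r x. r \<in> carrier R \<and> x \<in> carrier M}"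

lemma sym_ideal_eq: "I = Idl\<^bsub>P\<^esub> relations"
  by (simp add: sym_ideal_def relations_def Let_def)

lemma var_closed: "x \<in> carrier M \<Longrightarrow> var x \<in> carrier P"
  by (simp add: mpoly_var_eq monomial_closed)

lemma const_closed: "r \<in> carrier R \<Longrightarrow> const r \<in> carrier P"
  by (simp add: mpoly_const_eq monomial_closed)

sublocale P: cring P by (rule mpoly_cring)

lemma relations_closed: "relations \<subseteq> carrier P"
  unfolding relations_def by (auto simp: var_closed const_closed)

lemma sym_ideal_ideal: "ideal I P"
  unfolding sym_ideal_eq by (rule P.genideal_ideal[OF relations_closed])

text \<open>The quotient map from polynomials to the symmetric algebra, with the relabelling of cosets by
  elements of \<open>'u\<close> built in. Nothing below looks at cosets again: the symmetric algebra is handled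
  as the image of \<open>proj\<close>, with kernel \<open>I\<close>.\<close>

definition proj :: "('u multiset \<Rightarrow> 'u) \<Rightarrow> 'u" where
  "proj p = sym_emb R M (I +>\<^bsub>P\<^esub> p)"

lemma sym_gen_eq: "sym_gen R M x = proj (var x)"
  by (simp add: sym_gen_def proj_def)

lemma carrier_sym_alg_cosets: "carrier (sym_alg_cosets R M) = (\<lambda>p. I +>\<^bsub>P\<^esub> p) ` carrier P"
  by (auto simp: sym_alg_cosets_def Let_def FactRing_def A_RCOSETS_def')

lemma carrier_sym_alg: "carrier (sym_alg R M) = proj ` carrier P"
  by (simp add: sym_alg_def transport_def Let_def carrier_sym_alg_cosets image_image proj_def)

lemma proj_closed: "p \<in> carrier P \<Longrightarrow> proj p \<in> carrier (sym_alg R M)"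
  by (simp add: carrier_sym_alg)

lemma unembed: "p \<in> carrier P \<Longrightarrow>
    inv_into (carrier (sym_alg_cosets R M)) (sym_emb R M) (proj p) = I +>\<^bsub>P\<^esub> p"
  unfolding proj_def
  by (rule inv_into_f_f[OF sym_emb_inj]) (simp add: carrier_sym_alg_cosets)

lemma proj_eq_iff:
  assumes "p \<in> carrier P" "q \<in> carrier P"
  shows "proj p = proj q \<longleftrightarrow> p \<ominus>\<^bsub>P\<^esub> q \<in> I"
proof -
  have "proj p = proj q \<longleftrightarrow> I +>\<^bsub>P\<^esub> p = I +>\<^bsub>P\<^esub> q"
    unfolding proj_def
    by (rule inj_on_eq_iff[OF sym_emb_inj]) (use assms in \<open>auto simp: carrier_sym_alg_cosets\<close>)
  then show ?thesis
    using P.quotient_eq_iff_same_a_r_cos[OF sym_ideal_ideal assms] by simp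
qed

lemma proj_add:
  assumes "p \<in> carrier P" "q \<in> carrier P"
  shows "proj (p \<oplus>\<^bsub>P\<^esub> q) = proj p \<oplus>\<^bsub>sym_alg R M\<^esub> proj q"
  using assms ring_hom_add[OF ideal.rcos_ring_hom[OF sym_ideal_ideal] assms]
  by (simp add: sym_alg_def transport_def Let_def unembed)
     (simp add: proj_def sym_alg_cosets_def Let_def)

lemma proj_mult:
  assumes "p \<in> carrier P" "q \<in> carrier P"
  shows "proj (p \<otimes>\<^bsub>P\<^esub> q) = proj p \<otimes>\<^bsub>sym_alg R M\<^esub> proj q"
  using assms ring_hom_mult[OF ideal.rcos_ring_hom[OF sym_ideal_ideal] assms]
  by (simp add: sym_alg_def transport_def Let_def unembed)
     (simp add: proj_def sym_alg_cosets_def Let_def)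

lemma proj_smult:
  assumes "r \<in> carrier R" "p \<in> carrier P"
  shows "r \<odot>\<^bsub>sym_alg R M\<^esub> proj p = proj (const r) \<otimes>\<^bsub>sym_alg R M\<^esub> proj p"
  using assms
  by (simp add: sym_alg_def transport_def Let_def unembed const_closed)
     (simp add: proj_def sym_alg_cosets_def Let_def)

lemma proj_ring_hom: "proj \<in> ring_hom P (sym_alg R M)"
proof (rule ring_hom_memI)
  show "proj \<one>\<^bsub>P\<^esub> = \<one>\<^bsub>sym_alg R M\<^esub>"
    by (simp add: sym_alg_def transport_def Let_def proj_def sym_alg_cosets_def FactRing_def)
qed (simp_all add: proj_closed proj_add proj_mult)

lemma sym_alg_cring: "cring (sym_alg R M)"
proof (rule P.cring_surjective_image[OF proj_ring_hom])
  have "I +>\<^bsub>P\<^esub> \<zero>\<^bsub>P\<^esub> = I"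
    using additive_subgroup.a_subset[OF ideal.axioms(1)[OF sym_ideal_ideal]] by (rule P.a_coset_add_zero)
  then show "proj \<zero>\<^bsub>P\<^esub> = \<zero>\<^bsub>sym_alg R M\<^esub>"
    by (simp add: sym_alg_def transport_def Let_def proj_def sym_alg_cosets_def FactRing_def)
qed (simp add: carrier_sym_alg)

lemma const_ring_hom: "const \<in> ring_hom R P"
  by (rule ring_hom_memI)
     (simp_all add: monomial_closed mpoly_const_eq monomial_mult monomial_add mpoly_one)

text \<open>The scalar multiplication of the symmetric algebra is multiplication by the class of a constant
  polynomial, so the algebra axioms follow from the ring axioms.\<close>

lemma sym_alg_algebra: "algebra R (sym_alg R M)"
proof (rule algebra_of_ring_hom[OF R.is_cring sym_alg_cring])
  show "proj \<circ> const \<in> ring_hom R (sym_alg R M)"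
    using const_ring_hom proj_ring_hom by (rule ring_hom_trans)
  show "r \<odot>\<^bsub>sym_alg R M\<^esub> x = (proj \<circ> const) r \<otimes>\<^bsub>sym_alg R M\<^esub> x"
    if "r \<in> carrier R" "x \<in> carrier (sym_alg R M)" for r x
    using that by (auto simp: carrier_sym_alg proj_smult)
qed

text \<open>The two families of relations in the ideal say exactly that the generators depend additively and
  homogeneously on the elements of \<open>M\<close>.\<close>

lemma sym_gen_module_hom: "sym_gen R M \<in> module_hom R M (sym_alg R M)"
proof (rule module_homI)
  fix x y assume xy: "x \<in> carrier M" "y \<in> carrier M"
  then have "var (x \<oplus>\<^bsub>M\<^esub> y) \<ominus>\<^bsub>P\<^esub> (var x \<oplus>\<^bsub>P\<^esub> var y) \<in> I"
    unfolding sym_ideal_eq using P.genideal_self[OF relations_closed]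
    by (auto simp: relations_def)
  then show "sym_gen R M (x \<oplus>\<^bsub>M\<^esub> y) = sym_gen R M x \<oplus>\<^bsub>sym_alg R M\<^esub> sym_gen R M y"
    using xy by (simp add: sym_gen_eq var_closed proj_eq_iff flip: proj_add)
next
  fix r x assume rx: "r \<in> carrier R" "x \<in> carrier M"
  then have "var (r \<odot>\<^bsub>M\<^esub> x) \<ominus>\<^bsub>P\<^esub> (const r \<otimes>\<^bsub>P\<^esub> var x) \<in> I"
    unfolding sym_ideal_eq using P.genideal_self[OF relations_closed]
    by (auto simp: relations_def)
  then show "sym_gen R M (r \<odot>\<^bsub>M\<^esub> x) = r \<odot>\<^bsub>sym_alg R M\<^esub> sym_gen R M x"
    using rx by (simp add: sym_gen_eq var_closed const_closed proj_eq_iff proj_smult flip: proj_mult)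
qed (simp add: sym_gen_eq proj_closed var_closed)

lemma monomial_add_mset:
  assumes "c \<in> carrier R" "x \<in> carrier M" "set_mset m \<subseteq> carrier M"
  shows "monomial c (add_mset x m) = var x \<otimes>\<^bsub>P\<^esub> monomial c m"
  using assms by (simp add: mpoly_var_eq monomial_mult)

text \<open>Algebra maps that agree on the generators agree on constants, which are multiples of \<open>1\<close>, then on
  monomials by multiplying in one variable at a time, then on sums of terms.\<close>

lemma sym_alg_hom_unique:
  assumes B: "ring B"
    and \<phi>: "\<phi> \<in> algebra_hom R (sym_alg R M) B" and \<psi>: "\<psi> \<in> algebra_hom R (sym_alg R M) B"
    and gen: "\<And>x. x \<in> carrier M \<Longrightarrow> \<phi> (sym_gen R M x) = \<psi> (sym_gen R M x)"
    and y: "y \<in> carrier (sym_alg R M)"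
  shows "\<phi> y = \<psi> y"
proof -
  interpret S: algebra R "sym_alg R M" by (rule sym_alg_algebra)
  interpret S: cring "sym_alg R M" by (rule sym_alg_cring)
  note hom = algebra_hom_memD[OF \<phi>] algebra_hom_memD[OF \<psi>]
  have const: "\<phi> (proj (const r)) = \<psi> (proj (const r))" if "r \<in> carrier R" for r
  proof -
    \<comment> \<open>Algebra maps preserve multiples of one, which is how they act on constants.\<close>
    have "proj (const r) = r \<odot>\<^bsub>sym_alg R M\<^esub> \<one>\<^bsub>sym_alg R M\<^esub>"
      using that proj_smult[OF that P.one_closed]
      by (simp add: ring_hom_one[OF proj_ring_hom] proj_closed const_closed)
    then show ?thesis
      using that hom(2)[OF that S.one_closed] hom(4)[OF that S.one_closed]
      by (simp add: ring_hom_one[OF hom(1)] ring_hom_one[OF hom(3)])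
  qed
  have mon: "\<phi> (proj (monomial c m)) = \<psi> (proj (monomial c m))"
    if c: "c \<in> carrier R" and "set_mset m \<subseteq> carrier M" for c m
    using that(2)
  proof (induction m)
    case empty
    then show ?case using const[OF c] by (simp add: mpoly_const_eq)
  next
    case (add x m)
    then have "\<phi> (proj (var x)) = \<psi> (proj (var x))" using gen by (simp add: sym_gen_eq)
    with add c show ?case
      by (simp add: monomial_add_mset proj_mult var_closed monomial_closed proj_closed
          ring_hom_mult[OF hom(1)] ring_hom_mult[OF hom(3)])
  qed
  obtain p where p: "p \<in> carrier P" "y = proj p" using y unfolding carrier_sym_alg by blast
  have "\<phi> (proj p) = \<psi> (proj p)" using p(1)
  proof (induction p rule: mpoly_induct)
    case zero
    show ?case
      using ring_hom_zero[OF proj_ring_hom P.ring_axioms S.ring_axioms]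
        ring_hom_zero[OF hom(1) S.ring_axioms B] ring_hom_zero[OF hom(3) S.ring_axioms B]
      by simp
  next
    case (add c m p)
    then show ?case
      by (simp add: proj_add monomial_closed proj_closed mon
          ring_hom_add[OF hom(1)] ring_hom_add[OF hom(3)])
  qed
  then show ?thesis using p by simp
qed

text \<open>Evaluation at \<open>\<rho>\<close> sends each relation to an instance of the linearity of \<open>\<rho>\<close>, that is, to zero. So the ideal
  lies in its kernel and evaluation descends along \<open>proj\<close>.\<close>

lemma sym_alg_hom_exists:
  assumes B: "algebra R B" and \<rho>: "\<rho> \<in> module_hom R M B"
  shows "\<exists>\<phi>. \<phi> \<in> algebra_hom R (sym_alg R M) B \<and> (\<forall>x\<in>carrier M. \<phi> (sym_gen R M x) = \<rho> x)"
proof -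
  interpret B: algebra R B by (rule B)
  interpret B: cring B by (rule B.M_cring)
  interpret mpoly_eval R "carrier M" B \<rho>
    by unfold_locales (rule module_hom_memD(1)[OF \<rho>])
  interpret ev: ring_hom_ring P B eval
    by (rule ring_hom_ringI2[OF P.ring_axioms B.ring_axioms eval_ring_hom])
  have "relations \<subseteq> a_kernel P B eval"
    unfolding relations_def a_kernel_def'
    using \<rho> by (auto simp: var_closed const_closed eval_var eval_const module_hom_memD[OF \<rho>]
        a_minus_def B.r_neg B.smult_assoc2)
  then have I: "I \<subseteq> a_kernel P B eval"
    unfolding sym_ideal_eq by (rule P.genideal_minimal[OF ev.kernel_is_ideal])
  have wd: "eval p = eval q" if "p \<in> carrier P" "q \<in> carrier P" "proj p = proj q" for p q
  proof -
    have "eval (p \<ominus>\<^bsub>P\<^esub> q) = \<zero>\<^bsub>B\<^esub>"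
      using that I unfolding a_kernel_def' by (auto simp: proj_eq_iff)
    then have "eval p \<oplus>\<^bsub>B\<^esub> \<ominus>\<^bsub>B\<^esub> eval q = \<zero>\<^bsub>B\<^esub>" using that by (simp add: a_minus_def)
    then have "\<ominus>\<^bsub>B\<^esub> (\<ominus>\<^bsub>B\<^esub> eval q) = eval p" using that by (intro B.minus_equality) simp_all
    then show ?thesis using that by simp
  qed
  \<comment> \<open>Any preimage under \<open>proj\<close> may be used, by \<open>wd\<close>.\<close>
  define \<phi> where "\<phi> y = eval (inv_into (carrier P) proj y)" for y
  have \<phi>: "\<phi> (proj p) = eval p" if "p \<in> carrier P" for p
  proof -
    have "proj p \<in> proj ` carrier P" using that by blast
    then show ?thesis
      unfolding \<phi>_def using that f_inv_into_f[of "proj p" proj "carrier P"]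
      by (intro wd inv_into_into) simp_all
  qed
  have "\<phi> \<in> ring_hom (sym_alg R M) B"
  proof (rule ring_hom_memI)
    show "\<phi> \<one>\<^bsub>sym_alg R M\<^esub> = \<one>\<^bsub>B\<^esub>"
      unfolding ring_hom_one[OF proj_ring_hom, symmetric] by (simp add: \<phi>)
  qed (auto simp: carrier_sym_alg \<phi> simp flip: proj_add proj_mult)
  moreover have "\<phi> (r \<odot>\<^bsub>sym_alg R M\<^esub> x) = r \<odot>\<^bsub>B\<^esub> \<phi> x"
    if "r \<in> carrier R" "x \<in> carrier (sym_alg R M)" for r x
    using that
    by (auto simp: carrier_sym_alg \<phi> proj_smult const_closed eval_const B.smult_assoc2 simp flip: proj_mult)
  ultimately have "\<phi> \<in> algebra_hom R (sym_alg R M) B" by (simp add: algebra_hom_def)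
  moreover have "\<phi> (sym_gen R M x) = \<rho> x" if "x \<in> carrier M" for x
    using that by (simp add: sym_gen_eq \<phi> var_closed eval_var)
  ultimately show ?thesis by blast
qed

end

section \<open>The fibrations of modules and of algebras over rings\<close>

lemma Cring_cat_simps [simp]:
  "Ob Cring_cat = {R. cring R}"
  "Hom Cring_cat R S = ring_hom R S \<inter> extensional (carrier R)"
  "Ident Cring_cat R = (\<lambda>x\<in>carrier R. x)"
  "Comp Cring_cat R S T g f = compose (carrier R) g f"
  by (simp_all add: Cring_cat_def)

lemma proj_base_simps [simp]: "omap proj_base = fst" "amap proj_base X Y = fst"
  by (simp_all add: proj_base_def)

lemma ring_hom_funcset: "f \<in> ring_hom R S \<Longrightarrow> f \<in> carrier R \<rightarrow> carrier S"
  by (auto simp: ring_hom_def)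

lemma ring_hom_restrict_id: "ring R \<Longrightarrow> (\<lambda>x\<in>carrier R. x) \<in> ring_hom R R"
  by (rule ring_hom_memI) (simp_all add: ring.ring_simprules)

lemma ring_hom_compose:
  assumes "ring R" "f \<in> ring_hom R S" "g \<in> ring_hom S T"
  shows "compose (carrier R) g f \<in> ring_hom R T"
  using assms
  by (intro ring_hom_memI)
     (simp_all add: compose_def ring.ring_simprules ring_hom_closed ring_hom_add ring_hom_mult ring_hom_one)

lemma Cring_category: "is_category Cring_cat"
  unfolding is_category_def
  by (auto simp: ring_hom_restrict_id ring_hom_compose cring.axioms(1) compose_extensional
      intro!: Id_compose compose_Id compose_assoc ring_hom_funcset)

lemma restrict_scalars_simps [simp]:
  "carrier (restrict_scalars f N) = carrier N"
  "x \<oplus>\<^bsub>restrict_scalars f N\<^esub> y = x \<oplus>\<^bsub>N\<^esub> y"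
  "x \<otimes>\<^bsub>restrict_scalars f N\<^esub> y = x \<otimes>\<^bsub>N\<^esub> y"
  "\<zero>\<^bsub>restrict_scalars f N\<^esub> = \<zero>\<^bsub>N\<^esub>"
  "\<one>\<^bsub>restrict_scalars f N\<^esub> = \<one>\<^bsub>N\<^esub>"
  "r \<odot>\<^bsub>restrict_scalars f N\<^esub> x = f r \<odot>\<^bsub>N\<^esub> x"
  by (simp_all add: restrict_scalars_def)

lemma underlying_module_simps [simp]:
  "carrier (underlying_module A) = carrier A"
  "x \<oplus>\<^bsub>underlying_module A\<^esub> y = x \<oplus>\<^bsub>A\<^esub> y"
  "\<zero>\<^bsub>underlying_module A\<^esub> = \<zero>\<^bsub>A\<^esub>"
  "r \<odot>\<^bsub>underlying_module A\<^esub> x = r \<odot>\<^bsub>A\<^esub> x"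
  "underlying_module (underlying_module A) = underlying_module A"
  by (simp_all add: underlying_module_def)

lemma underlying_module_restrict_scalars:
  "underlying_module (restrict_scalars f A) = restrict_scalars f (underlying_module A)"
  by (cases A) (simp add: underlying_module_def restrict_scalars_def)

text \<open>Restriction of scalars and erasing the multiplication do not touch the additive structure.\<close>

lemma abelian_group_cong:
  assumes "abelian_group M" "carrier N = carrier M"
    "\<And>x y. x \<oplus>\<^bsub>N\<^esub> y = x \<oplus>\<^bsub>M\<^esub> y" "\<zero>\<^bsub>N\<^esub> = \<zero>\<^bsub>M\<^esub>"
  shows "abelian_group N"
proof -
  interpret M: abelian_group M by fact
  show ?thesis
  proof (rule abelian_groupI)
    show "\<exists>y\<in>carrier N. y \<oplus>\<^bsub>N\<^esub> x = \<zero>\<^bsub>N\<^esub>" if "x \<in> carrier N" for x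
      using that M.l_neg[of x] M.a_inv_closed[of x] by (auto simp: assms)
  qed (simp_all add: assms M.a_assoc M.a_comm M.a_lcomm)
qed

lemma module_restrict_scalars:
  assumes N: "Module.module S N" and R: "cring R" and f: "f \<in> ring_hom R S"
  shows "Module.module R (restrict_scalars f N)"
proof -
  interpret N: Module.module S N by fact
  have "abelian_group (restrict_scalars f N)"
    by (rule abelian_group_cong[OF N.abelian_group_axioms]) simp_all
  with R show ?thesis
    using f by (intro moduleI)
      (simp_all add: ring_hom_closed ring_hom_add ring_hom_mult ring_hom_one
        N.smult_l_distr N.smult_r_distr N.smult_assoc1)
qed

lemma cring_restrict_scalars:
  assumes "cring A" shows "cring (restrict_scalars f A)"
proof -
  interpret A: cring A by fact
  show ?thesis
  proof (rule cringI)
    show "abelian_group (restrict_scalars f A)"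
      by (rule abelian_group_cong[OF A.abelian_group_axioms]) simp_all
    show "comm_monoid (restrict_scalars f A)"
      by (rule comm_monoidI) (simp_all add: A.m_assoc A.m_comm A.m_lcomm)
  qed (simp add: A.l_distr)
qed

lemma algebra_restrict_scalars:
  assumes A: "algebra S A" and R: "cring R" and f: "f \<in> ring_hom R S"
  shows "algebra R (restrict_scalars f A)"
proof -
  interpret A: algebra S A by fact
  show ?thesis
    using f by (intro algebraI[OF R cring_restrict_scalars[OF A.M_cring]])
      (simp_all add: ring_hom_closed ring_hom_add ring_hom_mult ring_hom_one
        A.smult_l_distr A.smult_r_distr A.smult_assoc1 A.smult_assoc2)
qed

lemma module_underlying_module:
  assumes "Module.module R M" shows "Module.module R (underlying_module M)"
proof -
  interpret M: Module.module R M by fact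
  have "abelian_group (underlying_module M)"
    by (rule abelian_group_cong[OF M.abelian_group_axioms]) simp_all
  then show ?thesis
    by (intro moduleI[OF M.R.is_cring]) (simp_all add: M.smult_l_distr M.smult_r_distr M.smult_assoc1)
qed

definition additive_hom :: "('r, 'm) module \<Rightarrow> ('r, 'n) module \<Rightarrow> ('m \<Rightarrow> 'n) set" where
  "additive_hom M N = {h \<in> carrier M \<rightarrow> carrier N.
     \<forall>x\<in>carrier M. \<forall>y\<in>carrier M. h (x \<oplus>\<^bsub>M\<^esub> y) = h x \<oplus>\<^bsub>N\<^esub> h y}"

text \<open>Modules and algebras over varying rings are both categories of pairs whose arrows \<open>(f, \<rho>)\<close> consist of a
  ring map \<open>f\<close> and an \<open>f\<close>-semilinear map \<open>\<rho>\<close>; only the condition \<open>K\<close> on \<open>\<rho>\<close> that does not mention scalars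
  differs (additive map, respectively ring homomorphism). Since \<open>K\<close> does not see the scalars, it is unchanged
  when the target is restricted along a ring map.\<close>

locale scalar_fibration =
  fixes obj :: "'u ring \<Rightarrow> ('u, 'u) module \<Rightarrow> bool"
    and K :: "('u, 'u) module \<Rightarrow> ('u, 'u) module \<Rightarrow> ('u \<Rightarrow> 'u) set"
    and C :: "('u ring \<times> ('u, 'u) module, ('u \<Rightarrow> 'u) \<times> ('u \<Rightarrow> 'u)) category"
  assumes obj_module: "obj R M \<Longrightarrow> Module.module R M"
    and obj_restrict: "\<lbrakk>obj S N; cring R; f \<in> ring_hom R S\<rbrakk> \<Longrightarrow> obj R (restrict_scalars f N)"
    and K_closed: "h \<in> K M N \<Longrightarrow> h \<in> carrier M \<rightarrow> carrier N"
    and K_ident: "obj R M \<Longrightarrow> (\<lambda>x\<in>carrier M. x) \<in> K M M"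
    and K_comp: "\<lbrakk>obj R M; h \<in> K M N; k \<in> K N L\<rbrakk> \<Longrightarrow> compose (carrier M) k h \<in> K M L"
    and K_restrict: "K M (restrict_scalars f N) = K M N"
    and Ob_C: "Ob C = {(R, M). obj R M}"
    and Hom_C: "Hom C (R, M) (S, N) = {(f, \<rho>). f \<in> Hom Cring_cat R S \<and> \<rho> \<in> K M N \<inter> extensional (carrier M) \<and>
        (\<forall>r\<in>carrier R. \<forall>x\<in>carrier M. \<rho> (r \<odot>\<^bsub>M\<^esub> x) = f r \<odot>\<^bsub>N\<^esub> \<rho> x)}"
    and Ident_C: "Ident C (R, M) = (\<lambda>x\<in>carrier R. x, \<lambda>x\<in>carrier M. x)"
    and Comp_C: "Comp C (R, M) (S, N) (T, L) (g, \<phi>) (f, \<rho>) =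
        (compose (carrier R) g f, compose (carrier M) \<phi> \<rho>)"
begin

lemma obj_cring: "obj R M \<Longrightarrow> cring R"
  by (rule module.axioms(1)[OF obj_module])

lemma obj_smult_closed: "\<lbrakk>obj R M; r \<in> carrier R; x \<in> carrier M\<rbrakk> \<Longrightarrow> r \<odot>\<^bsub>M\<^esub> x \<in> carrier M"
  by (rule module.smult_closed[OF obj_module])

lemma ident_in_Hom: "obj R M \<Longrightarrow> Ident C (R, M) \<in> Hom C (R, M) (R, M)"
  by (auto simp: Hom_C Ident_C K_ident obj_smult_closed ring_hom_restrict_id cring.axioms(1) obj_cring)

lemma comp_in_Hom:
  assumes "obj R M" "(f, \<rho>) \<in> Hom C (R, M) (S, N)" "(g, \<phi>) \<in> Hom C (S, N) (T, L)"
  shows "(compose (carrier R) g f, compose (carrier M) \<phi> \<rho>) \<in> Hom C (R, M) (T, L)"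
proof -
  have \<rho>: "\<rho> \<in> carrier M \<rightarrow> carrier N" and f: "f \<in> carrier R \<rightarrow> carrier S"
    using assms K_closed[of \<rho> M N] ring_hom_funcset[of f R S] by (auto simp: Hom_C)
  have "compose (carrier R) g f \<in> ring_hom R T"
    using assms by (intro ring_hom_compose) (auto simp: Hom_C obj_cring cring.axioms(1))
  moreover have "compose (carrier M) \<phi> \<rho> \<in> K M L"
    using assms by (intro K_comp) (auto simp: Hom_C)
  ultimately show ?thesis
    using assms \<rho> f by (auto simp: Hom_C compose_eq obj_smult_closed compose_extensional Pi_iff)
qed

lemma category: "is_category C"
  unfolding is_category_def Ob_C
proof (intro conjI ballI; clarify)
  fix R M assume "obj R M"
  then show "Ident C (R, M) \<in> Hom C (R, M) (R, M)" by (rule ident_in_Hom)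
next
  fix R M S N T L f \<rho> g \<phi>
  assume "obj R M" "(f, \<rho>) \<in> Hom C (R, M) (S, N)" "(g, \<phi>) \<in> Hom C (S, N) (T, L)"
  then show "Comp C (R, M) (S, N) (T, L) (g, \<phi>) (f, \<rho>) \<in> Hom C (R, M) (T, L)"
    unfolding Comp_C by (rule comp_in_Hom)
next
  fix R M S N f \<rho> assume "(f, \<rho>) \<in> Hom C (R, M) (S, N)"
  then show "Comp C (R, M) (S, N) (S, N) (Ident C (S, N)) (f, \<rho>) = (f, \<rho>)"
    "Comp C (R, M) (R, M) (S, N) (f, \<rho>) (Ident C (R, M)) = (f, \<rho>)"
    using K_closed[of \<rho> M N] ring_hom_funcset[of f R S]
    by (auto simp: Hom_C Ident_C Comp_C intro!: Id_compose compose_Id)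
next
  fix Q A R M S N T L e \<sigma> f \<rho> g \<phi>
  assume "(e, \<sigma>) \<in> Hom C (Q, A) (R, M)"
  then show "Comp C (Q, A) (S, N) (T, L) (g, \<phi>) (Comp C (Q, A) (R, M) (S, N) (f, \<rho>) (e, \<sigma>)) =
    Comp C (Q, A) (R, M) (T, L) (Comp C (R, M) (S, N) (T, L) (g, \<phi>) (f, \<rho>)) (e, \<sigma>)"
    using K_closed[of \<sigma> A M] ring_hom_funcset[of e Q R] by (auto simp: Hom_C Comp_C intro!: compose_assoc)
qed

lemma proj_functor: "is_functor C Cring_cat proj_base"
  unfolding is_functor_def using category Cring_category
  by (auto simp: Ob_C Hom_C Ident_C Comp_C obj_cring)

text \<open>Over \<open>g = u \<circ> w\<close>, a \<open>g\<close>-semilinear map into \<open>N\<close> is the same function as a \<open>w\<close>-semilinear map into the restriction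
  of \<open>N\<close> along \<open>u\<close>. This function is the unique factorization, because composing with the identity
  map of \<open>N\<close> changes nothing.\<close>

lemma cartesian_restrict_scalars:
  assumes N: "obj S N" and R: "cring R" and u: "u \<in> Hom Cring_cat R S"
  shows "is_cartesian C Cring_cat proj_base (R, restrict_scalars u N) (S, N) (u, \<lambda>x\<in>carrier N. x)"
proof -
  have obj: "obj R (restrict_scalars u N)" using assms by (intro obj_restrict) auto
  have "(u, \<lambda>x\<in>carrier N. x) \<in> Hom C (R, restrict_scalars u N) (S, N)"
    using u K_ident[OF obj] obj_smult_closed[OF obj] by (auto simp: Hom_C K_restrict)
  moreover have "\<exists>!h. h \<in> Hom C (T, L) (R, restrict_scalars u N) \<and> fst h = w \<and>
      Comp C (T, L) (R, restrict_scalars u N) (S, N) (u, \<lambda>x\<in>carrier N. x) h = (g, \<phi>)"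
    if "obj T L" and g: "(g, \<phi>) \<in> Hom C (T, L) (S, N)" and w: "w \<in> Hom Cring_cat T R"
      and eq: "compose (carrier T) u w = g" for T L g \<phi> w
  proof (rule ex1I[of _ "(w, \<phi>)"])
    have \<phi>: "\<phi> \<in> carrier L \<rightarrow> carrier N" using g K_closed[of \<phi> L N] by (auto simp: Hom_C)
    show "(w, \<phi>) \<in> Hom C (T, L) (R, restrict_scalars u N) \<and> fst (w, \<phi>) = w \<and>
      Comp C (T, L) (R, restrict_scalars u N) (S, N) (u, \<lambda>x\<in>carrier N. x) (w, \<phi>) = (g, \<phi>)"
      using g w \<phi> by (auto simp: Hom_C Comp_C K_restrict eq[symmetric] compose_eq Id_compose)
    fix h assume h: "h \<in> Hom C (T, L) (R, restrict_scalars u N) \<and> fst h = w \<and>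
      Comp C (T, L) (R, restrict_scalars u N) (S, N) (u, \<lambda>x\<in>carrier N. x) h = (g, \<phi>)"
    obtain \<psi> where \<psi>: "h = (w, \<psi>)" using h by (cases h) auto
    have "\<psi> \<in> carrier L \<rightarrow> carrier N" "\<psi> \<in> extensional (carrier L)"
      using h K_closed[of \<psi> L N] unfolding \<psi> by (auto simp: Hom_C K_restrict)
    then have "compose (carrier L) (\<lambda>x\<in>carrier N. x) \<psi> = \<psi>" by (rule Id_compose)
    then show "h = (w, \<phi>)" using h by (simp add: \<psi> Comp_C)
  qed
  ultimately show ?thesis
    unfolding is_cartesian_def Ob_C
    by (clarsimp simp del: Cring_cat_simps(2))
qed

lemma fibration: "is_fibration C Cring_cat proj_base"
  unfolding is_fibration_def
proof (intro conjI ballI)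
  show "is_functor C Cring_cat proj_base" by (rule proj_functor)
  fix Y R u assume "Y \<in> Ob C" "R \<in> Ob Cring_cat" and u: "u \<in> Hom Cring_cat R (omap proj_base Y)"
  then obtain S N where Y: "Y = (S, N)" "obj S N" and R: "cring R" by (auto simp: Ob_C)
  have u: "u \<in> Hom Cring_cat R S" using u by (simp add: Y)
  have "(R, restrict_scalars u N) \<in> Ob C" using obj_restrict[OF Y(2) R] u by (simp add: Ob_C)
  with cartesian_restrict_scalars[OF Y(2) R u]
  show "\<exists>X\<in>Ob C. \<exists>f. omap proj_base X = R \<and> amap proj_base X Y f = u \<and>
      is_cartesian C Cring_cat proj_base X Y f"
    unfolding Y(1) by (intro bexI[of _ "(R, restrict_scalars u N)"] exI[of _ "(u, \<lambda>x\<in>carrier N. x)"]) simp_all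
qed

end

interpretation Mod: scalar_fibration
  "\<lambda>R M. Module.module R M \<and> underlying_module M = M" additive_hom Mod_cat
proof (rule scalar_fibration.intro)
  fix S R :: "'u ring" and N :: "('u, 'u) module" and f
  assume "Module.module S N \<and> underlying_module N = N" "cring R" "f \<in> ring_hom R S"
  then show "Module.module R (restrict_scalars f N) \<and> underlying_module (restrict_scalars f N) = restrict_scalars f N"
    by (auto intro: module_restrict_scalars simp: underlying_module_restrict_scalars)
next
  fix R :: "'u ring" and M :: "('u, 'u) module"
  assume "Module.module R M \<and> underlying_module M = M"
  then interpret Module.module R M by simp
  show "(\<lambda>x\<in>carrier M. x) \<in> additive_hom M M" by (auto simp: additive_hom_def)
next
  fix R :: "'u ring" and M N L :: "('u, 'u) module" and h k
  assume "Module.module R M \<and> underlying_module M = M"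
  then interpret Module.module R M by simp
  show "h \<in> additive_hom M N \<Longrightarrow> k \<in> additive_hom N L \<Longrightarrow> compose (carrier M) k h \<in> additive_hom M L"
    by (auto simp: additive_hom_def compose_eq Pi_iff)
qed (auto simp: additive_hom_def Mod_cat_def module_hom_def)

interpretation CAlg: scalar_fibration algebra ring_hom CAlg_cat
proof (rule scalar_fibration.intro)
  fix R :: "'u ring" and A B D :: "('u, 'u) module" and h k
  assume A: "algebra R A"
  interpret A: algebra R A by fact
  show "Module.module R A" by (rule A.module)
  show "(\<lambda>x\<in>carrier A. x) \<in> ring_hom A A" by (rule ring_hom_restrict_id) unfold_locales
  show "h \<in> ring_hom A B \<Longrightarrow> k \<in> ring_hom B D \<Longrightarrow> compose (carrier A) k h \<in> ring_hom A D"
    by (rule ring_hom_compose) unfold_locales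
qed (auto simp: algebra_restrict_scalars ring_hom_def CAlg_cat_def algebra_hom_def)

section \<open>Adjunctions from universal arrows\<close>

lemma category_laws:
  assumes "is_category C"
  shows ident_hom: "X \<in> Ob C \<Longrightarrow> Ident C X \<in> Hom C X X"
    and comp_hom: "\<lbrakk>X \<in> Ob C; Y \<in> Ob C; Z \<in> Ob C; f \<in> Hom C X Y; g \<in> Hom C Y Z\<rbrakk> \<Longrightarrow>
      Comp C X Y Z g f \<in> Hom C X Z"
    and comp_ident_left: "\<lbrakk>X \<in> Ob C; Y \<in> Ob C; f \<in> Hom C X Y\<rbrakk> \<Longrightarrow> Comp C X Y Y (Ident C Y) f = f"
    and comp_ident_right: "\<lbrakk>X \<in> Ob C; Y \<in> Ob C; f \<in> Hom C X Y\<rbrakk> \<Longrightarrow> Comp C X X Y f (Ident C X) = f"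
    and comp_assoc: "\<lbrakk>W \<in> Ob C; X \<in> Ob C; Y \<in> Ob C; Z \<in> Ob C;
      f \<in> Hom C W X; g \<in> Hom C X Y; h \<in> Hom C Y Z\<rbrakk> \<Longrightarrow>
      Comp C W X Z (Comp C X Y Z h g) f = Comp C W Y Z h (Comp C W X Y g f)"
  using assms unfolding is_category_def by simp_all

lemma functor_laws:
  assumes "is_functor C D F"
  shows functor_source: "is_category C" and functor_target: "is_category D"
    and functor_Ob: "X \<in> Ob C \<Longrightarrow> omap F X \<in> Ob D"
    and functor_Hom: "\<lbrakk>X \<in> Ob C; Y \<in> Ob C; f \<in> Hom C X Y\<rbrakk> \<Longrightarrow>
      amap F X Y f \<in> Hom D (omap F X) (omap F Y)"
    and functor_Ident: "X \<in> Ob C \<Longrightarrow> amap F X X (Ident C X) = Ident D (omap F X)"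
    and functor_Comp: "\<lbrakk>X \<in> Ob C; Y \<in> Ob C; Z \<in> Ob C; f \<in> Hom C X Y; g \<in> Hom C Y Z\<rbrakk> \<Longrightarrow>
      amap F X Z (Comp C X Y Z g f) =
      Comp D (omap F X) (omap F Y) (omap F Z) (amap F Y Z g) (amap F X Y f)"
  using assms unfolding is_functor_def by simp_all

lemma id_functor_functor: "is_category C \<Longrightarrow> is_functor C C id_functor"
  by (simp add: is_functor_def id_functor_def)

lemma comp_functor_functor:
  assumes F: "is_functor C D F" and G: "is_functor D E G"
  shows "is_functor C E (comp_functor G F)"
  using functor_laws[OF F] functor_laws[OF G]
  unfolding is_functor_def comp_functor_def by simp

text \<open>A functor \<open>G\<close> with a universal arrow \<open>\<eta> X : X \<rightarrow> G (F X)\<close> for every \<open>X\<close> has \<open>F\<close> as left adjoint. The action of \<open>F\<close>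
  on arrows is given in advance, and \<open>unit_natural\<close> characterizes it; that \<open>F\<close> preserves identities
  and composition is a consequence.\<close>

locale universal_arrows =
  fixes C :: "('o, 'm) category" and D :: "('p, 'n) category"
    and F :: "('o, 'm, 'p, 'n) cat_functor" and G :: "('p, 'n, 'o, 'm) cat_functor"
    and \<eta> :: "'o \<Rightarrow> 'm"
  assumes G: "is_functor D C G"
    and F_Ob: "X \<in> Ob C \<Longrightarrow> omap F X \<in> Ob D"
    and F_Hom: "\<lbrakk>X \<in> Ob C; Y \<in> Ob C; f \<in> Hom C X Y\<rbrakk> \<Longrightarrow>
      amap F X Y f \<in> Hom D (omap F X) (omap F Y)"
    and unit_Hom: "X \<in> Ob C \<Longrightarrow> \<eta> X \<in> Hom C X (omap G (omap F X))"
    and unit_natural: "\<lbrakk>X \<in> Ob C; Y \<in> Ob C; f \<in> Hom C X Y\<rbrakk> \<Longrightarrow>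
      Comp C X (omap G (omap F X)) (omap G (omap F Y))
        (amap G (omap F X) (omap F Y) (amap F X Y f)) (\<eta> X) =
      Comp C X Y (omap G (omap F Y)) (\<eta> Y) f"
    and universal: "\<lbrakk>X \<in> Ob C; A \<in> Ob D; h \<in> Hom C X (omap G A)\<rbrakk> \<Longrightarrow>
      \<exists>!k. k \<in> Hom D (omap F X) A \<and>
        Comp C X (omap G (omap F X)) (omap G A) (amap G (omap F X) A k) (\<eta> X) = h"
begin

text \<open>The adjoint transpose \<open>G k \<circ> \<eta> X\<close> of \<open>k : F X \<rightarrow> Y\<close>. By universality it is injective in \<open>k\<close>, so every equation
  between arrows out of some \<open>F X\<close> below is proved by comparing transposes.\<close>

definition transpose :: "'o \<Rightarrow> 'p \<Rightarrow> 'n \<Rightarrow> 'm" where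
  "transpose X Y k = Comp C X (omap G (omap F X)) (omap G Y) (amap G (omap F X) Y k) (\<eta> X)"

lemmas C = category_laws[OF functor_target[OF G]]
lemmas D = category_laws[OF functor_source[OF G]]
lemmas GF = functor_laws(3-)[OF G]

lemma transpose_Hom: "\<lbrakk>X \<in> Ob C; Y \<in> Ob D; k \<in> Hom D (omap F X) Y\<rbrakk> \<Longrightarrow>
    transpose X Y k \<in> Hom C X (omap G Y)"
  unfolding transpose_def by (intro C(2) GF unit_Hom F_Ob)

lemma transpose_inject:
  assumes "X \<in> Ob C" "Y \<in> Ob D" "k \<in> Hom D (omap F X) Y" "l \<in> Hom D (omap F X) Y"
    and "transpose X Y k = transpose X Y l"
  shows "k = l"
proof -
  have "transpose X Y k \<in> Hom C X (omap G Y)" using assms(1-3) by (rule transpose_Hom)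
  from universal[OF assms(1,2) this, folded transpose_def] show ?thesis
    by (elim ex1E) (metis assms(3-5))
qed

lemma transpose_Ident: "X \<in> Ob C \<Longrightarrow> transpose X (omap F X) (Ident D (omap F X)) = \<eta> X"
  unfolding transpose_def by (simp add: GF F_Ob C(3) unit_Hom)

lemma transpose_F: "\<lbrakk>X \<in> Ob C; Y \<in> Ob C; f \<in> Hom C X Y\<rbrakk> \<Longrightarrow>
    transpose X (omap F Y) (amap F X Y f) = Comp C X Y (omap G (omap F Y)) (\<eta> Y) f"
  unfolding transpose_def by (rule unit_natural)

lemma transpose_Comp:
  assumes "X \<in> Ob C" "Y \<in> Ob D" "Z \<in> Ob D" "k \<in> Hom D (omap F X) Y" "l \<in> Hom D Y Z"
  shows "transpose X Z (Comp D (omap F X) Y Z l k) =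
    Comp C X (omap G Y) (omap G Z) (amap G Y Z l) (transpose X Y k)"
  unfolding transpose_def using assms by (simp add: GF F_Ob C(5) unit_Hom)

lemma transpose_Comp_F:
  assumes "W \<in> Ob C" "X \<in> Ob C" "Y \<in> Ob D" "f \<in> Hom C W X" "k \<in> Hom D (omap F X) Y"
  shows "transpose W Y (Comp D (omap F W) (omap F X) Y k (amap F W X f)) =
    Comp C W X (omap G Y) (transpose X Y k) f"
proof -
  have "transpose W Y (Comp D (omap F W) (omap F X) Y k (amap F W X f)) =
    Comp C W (omap G (omap F X)) (omap G Y) (amap G (omap F X) Y k)
      (Comp C W X (omap G (omap F X)) (\<eta> X) f)"
    using assms by (simp add: transpose_Comp F_Ob F_Hom transpose_F)
  also have "\<dots> = Comp C W X (omap G Y) (transpose X Y k) f"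
    unfolding transpose_def using assms by (intro C(5)[symmetric] GF unit_Hom F_Ob)
  finally show ?thesis .
qed

lemma F_functor: "is_functor C D F"
  unfolding is_functor_def
proof (intro conjI ballI)
  show "is_category C" "is_category D" using functor_laws(1,2)[OF G] by auto
next
  fix X assume X: "X \<in> Ob C"
  show "amap F X X (Ident C X) = Ident D (omap F X)"
    by (rule transpose_inject[of X "omap F X"])
       (use X in \<open>simp_all add: F_Ob F_Hom C(1) D(1) transpose_F transpose_Ident C(4) unit_Hom GF\<close>)
next
  fix X Y Z f g
  assume *: "X \<in> Ob C" "Y \<in> Ob C" "Z \<in> Ob C" "f \<in> Hom C X Y" "g \<in> Hom C Y Z"
  note ** = * comp_hom[OF functor_target[OF G] *]
  show "amap F X Z (Comp C X Y Z g f) =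
    Comp D (omap F X) (omap F Y) (omap F Z) (amap F Y Z g) (amap F X Y f)"
  proof (rule transpose_inject[of X "omap F Z"])
    show "transpose X (omap F Z) (amap F X Z (Comp C X Y Z g f)) =
      transpose X (omap F Z) (Comp D (omap F X) (omap F Y) (omap F Z) (amap F Y Z g) (amap F X Y f))"
      using ** by (simp add: transpose_F transpose_Comp_F F_Ob F_Hom C(5) unit_Hom GF)
  qed (use ** in \<open>auto intro!: F_Ob F_Hom D(2)\<close>)
qed (fact F_Ob F_Hom)+

text \<open>The counit at \<open>Y\<close> is the arrow whose transpose is the identity of \<open>G Y\<close>, which is one triangle identity by
  definition. This equation is recorded again in the conclusion, since it also determines the image
  of the counit in a base category.\<close>

lemma adjunction:
  "\<exists>\<epsilon>. is_adjunction C D F G \<eta> \<epsilon> \<and>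
     (\<forall>Y\<in>Ob D. \<epsilon> Y \<in> Hom D (omap F (omap G Y)) Y \<and>
       Comp C (omap G Y) (omap G (omap F (omap G Y))) (omap G Y)
         (amap G (omap F (omap G Y)) Y (\<epsilon> Y)) (\<eta> (omap G Y)) = Ident C (omap G Y))"
proof -
  have "\<exists>k. k \<in> Hom D (omap F (omap G Y)) Y \<and> transpose (omap G Y) Y k = Ident C (omap G Y)"
    if "Y \<in> Ob D" for Y
    using universal[of "omap G Y" Y "Ident C (omap G Y)"] that
    unfolding transpose_def by (blast intro: GF C(1))
  then obtain \<epsilon> where \<epsilon>: "\<And>Y. Y \<in> Ob D \<Longrightarrow> \<epsilon> Y \<in> Hom D (omap F (omap G Y)) Y"
    "\<And>Y. Y \<in> Ob D \<Longrightarrow> transpose (omap G Y) Y (\<epsilon> Y) = Ident C (omap G Y)"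
    by metis
  have "is_natural C C id_functor (comp_functor G F) \<eta>"
    unfolding is_natural_def
    using id_functor_functor[OF functor_target[OF G]] comp_functor_functor[OF F_functor G]
    by (simp add: unit_Hom unit_natural id_functor_def comp_functor_def)
  moreover have "Comp D (omap F (omap G X)) (omap F (omap G Y)) Y (\<epsilon> Y)
      (amap F (omap G X) (omap G Y) (amap G X Y f)) =
    Comp D (omap F (omap G X)) X Y f (\<epsilon> X)"
    if "X \<in> Ob D" "Y \<in> Ob D" "f \<in> Hom D X Y" for X Y f
  proof (rule transpose_inject[of "omap G X" Y])
    show "transpose (omap G X) Y (Comp D (omap F (omap G X)) (omap F (omap G Y)) Y (\<epsilon> Y)
        (amap F (omap G X) (omap G Y) (amap G X Y f))) =
      transpose (omap G X) Y (Comp D (omap F (omap G X)) X Y f (\<epsilon> X))"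
      using that by (simp add: transpose_Comp_F transpose_Comp GF \<epsilon> C(3,4))
  qed (use that in \<open>auto intro!: F_Ob F_Hom D(2) GF \<epsilon>\<close>)
  then have "is_natural D D (comp_functor F G) id_functor \<epsilon>"
    unfolding is_natural_def
    using id_functor_functor[OF functor_source[OF G]] comp_functor_functor[OF G F_functor] \<epsilon>
    by (simp add: id_functor_def comp_functor_def)
  moreover have "Comp D (omap F X) (omap F (omap G (omap F X))) (omap F X)
      (\<epsilon> (omap F X)) (amap F X (omap G (omap F X)) (\<eta> X)) = Ident D (omap F X)"
    if "X \<in> Ob C" for X
  proof (rule transpose_inject[of X "omap F X"])
    show "transpose X (omap F X) (Comp D (omap F X) (omap F (omap G (omap F X))) (omap F X)
        (\<epsilon> (omap F X)) (amap F X (omap G (omap F X)) (\<eta> X))) =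
      transpose X (omap F X) (Ident D (omap F X))"
      using that by (simp add: transpose_Comp_F transpose_Ident GF F_Ob \<epsilon> C(3) unit_Hom)
  qed (use that in \<open>auto intro!: F_Ob F_Hom D(1,2) GF \<epsilon> unit_Hom\<close>)
  ultimately have "is_adjunction C D F G \<eta> \<epsilon>"
    unfolding is_adjunction_def using F_functor G \<epsilon>(2) by (simp add: transpose_def)
  then show ?thesis using \<epsilon> unfolding transpose_def by blast
qed

end

section \<open>The adjunction\<close>

lemma Und_functor_simps [simp]:
  "omap Und_functor (R, A) = (R, underlying_module A)"
  "amap Und_functor X Y f = f"
  by (simp_all add: Und_functor_def)

lemma omap_Sym [simp]: "omap Sym_functor (R, M) = (R, sym_alg R M)"
  by (simp add: Sym_functor_def)

lemma Hom_CAlg: "(f, \<rho>) \<in> Hom CAlg_cat (R, A) (S, B) \<longleftrightarrow> f \<in> Hom Cring_cat R S \<and>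
    \<rho> \<in> algebra_hom R A (restrict_scalars f B) \<and> \<rho> \<in> extensional (carrier A)"
  by (simp add: CAlg_cat_def)

lemma Hom_Mod: "(f, \<rho>) \<in> Hom Mod_cat (R, M) (S, N) \<longleftrightarrow> f \<in> Hom Cring_cat R S \<and>
    \<rho> \<in> module_hom R M (restrict_scalars f N) \<and> \<rho> \<in> extensional (carrier M)"
  by (simp add: Mod_cat_def)

lemma module_hom_underlying_module: "module_hom R M (restrict_scalars f (underlying_module B)) =
    module_hom R M (restrict_scalars f B)"
  by (simp add: module_hom_def)

lemma Und_is_functor: "is_functor CAlg_cat Mod_cat Und_functor"
  unfolding is_functor_def
proof (intro conjI ballI; clarify?)
  show "is_category CAlg_cat" "is_category Mod_cat" by (rule CAlg.category Mod.category)+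
next
  fix R A assume "(R, A) \<in> Ob CAlg_cat"
  then show "omap Und_functor (R, A) \<in> Ob Mod_cat"
    by (auto simp: CAlg.Ob_C Mod.Ob_C intro: module_underlying_module algebra.module)
qed (auto simp: CAlg.Hom_C Mod.Hom_C CAlg.Ident_C Mod.Ident_C CAlg.Comp_C Mod.Comp_C
      additive_hom_def ring_hom_def)

lemma sym_algebraI: "Module.module R M \<Longrightarrow> sym_algebra R M"
  by (simp add: sym_algebra_def mpoly_def module.axioms(1))

text \<open>The universal property along a ring map \<open>f : R \<rightarrow> S\<close> is the one over \<open>R\<close>, applied to the target with its
  scalars restricted along \<open>f\<close>. Requiring extensional maps turns agreement on the carrier into equality.\<close>

lemma sym_extension:
  fixes R S :: "'u::infinite ring"
  assumes M: "Module.module R M" and B: "algebra S B" and f: "f \<in> Hom Cring_cat R S"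
    and \<rho>: "\<rho> \<in> module_hom R M (restrict_scalars f B)"
  shows "\<exists>!\<phi>. \<phi> \<in> algebra_hom R (sym_alg R M) (restrict_scalars f B) \<and>
    \<phi> \<in> extensional (carrier (sym_alg R M)) \<and> (\<forall>x\<in>carrier M. \<phi> (sym_gen R M x) = \<rho> x)"
proof -
  interpret sym_algebra R M using M by (rule sym_algebraI)
  interpret S: cring "sym_alg R M" by (rule sym_alg_cring)
  interpret S: algebra R "sym_alg R M" by (rule sym_alg_algebra)
  let ?B = "restrict_scalars f B"
  have B': "algebra R ?B"
    using f by (intro algebra_restrict_scalars[OF B R.is_cring]) simp
  then interpret B: cring ?B by (rule algebra.M_cring)
  obtain \<phi> where \<phi>: "\<phi> \<in> algebra_hom R (sym_alg R M) ?B" "\<forall>x\<in>carrier M. \<phi> (sym_gen R M x) = \<rho> x"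
    using sym_alg_hom_exists[OF B' \<rho>] by blast
  let ?\<phi> = "restrict \<phi> (carrier (sym_alg R M))"
  show ?thesis
  proof (rule ex1I[of _ ?\<phi>])
    have "?\<phi> \<in> algebra_hom R (sym_alg R M) ?B"
      using \<phi>(1) by (auto simp: algebra_hom_def ring_hom_def)
    then show "?\<phi> \<in> algebra_hom R (sym_alg R M) ?B \<and> ?\<phi> \<in> extensional (carrier (sym_alg R M)) \<and>
        (\<forall>x\<in>carrier M. ?\<phi> (sym_gen R M x) = \<rho> x)"
      using \<phi>(2) module_hom_memD(1)[OF sym_gen_module_hom] by simp
    fix \<psi> assume \<psi>: "\<psi> \<in> algebra_hom R (sym_alg R M) ?B \<and> \<psi> \<in> extensional (carrier (sym_alg R M)) \<and>
        (\<forall>x\<in>carrier M. \<psi> (sym_gen R M x) = \<rho> x)"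
    show "\<psi> = ?\<phi>"
    proof (rule extensionalityI)
      show "\<psi> y = ?\<phi> y" if "y \<in> carrier (sym_alg R M)" for y
        using sym_alg_hom_unique[OF B.ring_axioms, of \<psi> \<phi> y] \<psi> \<phi> that by simp
    qed (use \<psi> in auto)
  qed
qed

definition sym_unit :: "'u ring \<times> ('u, 'u) module \<Rightarrow> ('u \<Rightarrow> 'u) \<times> ('u \<Rightarrow> 'u)" where
  "sym_unit = (\<lambda>(R, M). (\<lambda>x\<in>carrier R. x, \<lambda>x\<in>carrier M. sym_gen R M x))"

text \<open>The map that \<open>Sym_functor\<close> selects by a definite description is the extension of \<open>x \<mapsto> sym_gen S N (\<rho> x)\<close>,
  which exists and is unique.\<close>

lemma amap_Sym:
  fixes R S :: "'u::infinite ring"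
  assumes M: "Module.module R M" and N: "Module.module S N"
    and f: "(f, \<rho>) \<in> Hom Mod_cat (R, M) (S, N)"
  obtains \<phi> where "amap Sym_functor (R, M) (S, N) (f, \<rho>) = (f, \<phi>)"
    "(f, \<phi>) \<in> Hom CAlg_cat (R, sym_alg R M) (S, sym_alg S N)"
    "\<And>x. x \<in> carrier M \<Longrightarrow> \<phi> (sym_gen R M x) = sym_gen S N (\<rho> x)"
proof -
  interpret N: sym_algebra S N using N by (rule sym_algebraI)
  note gen = module_hom_memD[OF N.sym_gen_module_hom]
  have f': "f \<in> Hom Cring_cat R S" and \<rho>: "\<rho> \<in> module_hom R M (restrict_scalars f N)"
    using f by (simp_all add: Hom_Mod)
  have "f r \<in> carrier S" if "r \<in> carrier R" for r using f' that by (auto intro: ring_hom_closed)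
  then have "(\<lambda>x. sym_gen S N (\<rho> x)) \<in> module_hom R M (restrict_scalars f (sym_alg S N))"
    using module_hom_memD[OF \<rho>] by (intro module_homI) (simp_all add: gen)
  note ex1 = sym_extension[OF M N.sym_alg_algebra f' this]
  define \<phi> where "\<phi> = (THE \<phi>. \<phi> \<in> algebra_hom R (sym_alg R M) (restrict_scalars f (sym_alg S N)) \<and>
    \<phi> \<in> extensional (carrier (sym_alg R M)) \<and> (\<forall>x\<in>carrier M. \<phi> (sym_gen R M x) = sym_gen S N (\<rho> x)))"
  have \<phi>: "\<phi> \<in> algebra_hom R (sym_alg R M) (restrict_scalars f (sym_alg S N)) \<and>
    \<phi> \<in> extensional (carrier (sym_alg R M)) \<and> (\<forall>x\<in>carrier M. \<phi> (sym_gen R M x) = sym_gen S N (\<rho> x))"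
    unfolding \<phi>_def by (rule theI'[OF ex1])
  show thesis
  proof (rule that[of \<phi>])
    show "amap Sym_functor (R, M) (S, N) (f, \<rho>) = (f, \<phi>)"
      by (simp add: Sym_functor_def \<phi>_def)
    show "(f, \<phi>) \<in> Hom CAlg_cat (R, sym_alg R M) (S, sym_alg S N)"
      using \<phi> f' by (simp add: Hom_CAlg)
  qed (use \<phi> in blast)
qed

lemma sym_universal_arrows:
  "universal_arrows (Mod_cat :: ('u::infinite ring \<times> ('u, 'u) module, _) category) CAlg_cat
     Sym_functor Und_functor sym_unit"
proof (rule universal_arrows.intro; (clarsimp simp: Mod.Ob_C CAlg.Ob_C)?)
  show "is_functor CAlg_cat Mod_cat Und_functor" by (rule Und_is_functor)
next
  fix R :: "'u ring" and M :: "('u, 'u) module"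
  assume M: "Module.module R M"
  then interpret sym_algebra R M by (rule sym_algebraI)
  show "algebra R (sym_alg R M)" by (rule sym_alg_algebra)
  show "sym_unit (R, M) \<in> Hom Mod_cat (R, M) (R, underlying_module (sym_alg R M))"
    using module_hom_memD[OF sym_gen_module_hom] ring_hom_restrict_id[OF R.ring_axioms]
    by (auto simp: sym_unit_def Mod.Hom_C additive_hom_def)
  fix S :: "'u ring" and N :: "('u, 'u) module" and f \<rho>
  assume N: "Module.module S N" and f: "(f, \<rho>) \<in> Hom Mod_cat (R, M) (S, N)"
  obtain \<phi> where \<phi>: "amap Sym_functor (R, M) (S, N) (f, \<rho>) = (f, \<phi>)"
    "(f, \<phi>) \<in> Hom CAlg_cat (R, sym_alg R M) (S, sym_alg S N)"
    "\<And>x. x \<in> carrier M \<Longrightarrow> \<phi> (sym_gen R M x) = sym_gen S N (\<rho> x)"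
    using amap_Sym[OF M N f] by blast
  then show "amap Sym_functor (R, M) (S, N) (f, \<rho>) \<in> Hom CAlg_cat (R, sym_alg R M) (S, sym_alg S N)"
    by simp
  have fR: "f \<in> carrier R \<rightarrow> carrier S" "f \<in> extensional (carrier R)"
    using f by (auto simp: Hom_Mod ring_hom_funcset)
  have \<rho>: "\<rho> x \<in> carrier N" if "x \<in> carrier M" for x
    using f that by (auto simp: Hom_Mod module_hom_def)
  have "compose (carrier M) \<phi> (\<lambda>x\<in>carrier M. sym_gen R M x) =
      compose (carrier M) (\<lambda>x\<in>carrier N. sym_gen S N x) \<rho>"
    by (auto simp: compose_def \<phi>(3) \<rho> intro!: restrict_ext)
  then show "Comp Mod_cat (R, M) (R, underlying_module (sym_alg R M)) (S, underlying_module (sym_alg S N))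
      (amap Sym_functor (R, M) (S, N) (f, \<rho>)) (sym_unit (R, M)) =
    Comp Mod_cat (R, M) (S, N) (S, underlying_module (sym_alg S N)) (sym_unit (S, N)) (f, \<rho>)"
    by (simp add: \<phi>(1) sym_unit_def Mod.Comp_C compose_Id[OF fR] Id_compose[OF fR])
next
  fix R S :: "'u ring" and M B :: "('u, 'u) module" and f \<rho>
  assume M: "Module.module R M" and B: "algebra S B"
    and h: "(f, \<rho>) \<in> Hom Mod_cat (R, M) (S, underlying_module B)"
  interpret sym_algebra R M using M by (rule sym_algebraI)
  have f: "f \<in> Hom Cring_cat R S" and \<rho>: "\<rho> \<in> module_hom R M (restrict_scalars f B)"
    "\<rho> \<in> extensional (carrier M)"
    using h by (simp_all add: Hom_Mod module_hom_underlying_module)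
  \<comment> \<open>Composing with the unit leaves the ring component unchanged and restricts the other component to
    the generators, so a factorization of \<open>(f, \<rho>)\<close> is the same as an extension of \<open>\<rho>\<close>.\<close>
  have transpose: "k \<in> Hom CAlg_cat (R, sym_alg R M) (S, B) \<and>
      Comp Mod_cat (R, M) (R, underlying_module (sym_alg R M)) (S, underlying_module B)
        k (sym_unit (R, M)) = (f, \<rho>) \<longleftrightarrow>
    fst k = f \<and> snd k \<in> algebra_hom R (sym_alg R M) (restrict_scalars f B) \<and>
      snd k \<in> extensional (carrier (sym_alg R M)) \<and> (\<forall>x\<in>carrier M. snd k (sym_gen R M x) = \<rho> x)" for k
  proof -
    obtain g \<phi> where k: "k = (g, \<phi>)" by (cases k)
    have "compose (carrier R) g (\<lambda>x\<in>carrier R. x) = g" if "g \<in> Hom Cring_cat R S"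
      using that by (intro compose_Id) (auto simp: ring_hom_funcset)
    moreover have "compose (carrier M) \<phi> (\<lambda>x\<in>carrier M. sym_gen R M x) = \<rho> \<longleftrightarrow>
        (\<forall>x\<in>carrier M. \<phi> (sym_gen R M x) = \<rho> x)"
      using \<rho>(2) by (auto simp: compose_def fun_eq_iff extensional_def)
    ultimately show ?thesis
      using f by (auto simp: k Hom_CAlg sym_unit_def Mod.Comp_C)
  qed
  from sym_extension[OF M B f \<rho>(1)]
  show "\<exists>!k. k \<in> Hom CAlg_cat (R, sym_alg R M) (S, B) \<and>
      Comp Mod_cat (R, M) (R, underlying_module (sym_alg R M)) (S, underlying_module B)
        k (sym_unit (R, M)) = (f, \<rho>)"
    unfolding transpose by (auto simp: Ex1_def)
qed

theorem proposition2p3p4: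
  "is_adjunction_over (Cring_cat :: ('u::infinite ring, 'u \<Rightarrow> 'u) category)
     Mod_cat proj_base CAlg_cat proj_base Sym_functor Und_functor"
proof -
  interpret universal_arrows "Mod_cat :: ('u ring \<times> ('u, 'u) module, _) category" CAlg_cat
    Sym_functor Und_functor sym_unit
    by (rule sym_universal_arrows)
  obtain \<epsilon> :: "'u ring \<times> ('u, 'u) module \<Rightarrow> ('u \<Rightarrow> 'u) \<times> ('u \<Rightarrow> 'u)"
    where adj: "is_adjunction Mod_cat CAlg_cat Sym_functor Und_functor sym_unit \<epsilon>"
      and \<epsilon>: "\<And>Y. Y \<in> Ob CAlg_cat \<Longrightarrow>
        \<epsilon> Y \<in> Hom CAlg_cat (omap Sym_functor (omap Und_functor Y)) Y"
        "\<And>Y. Y \<in> Ob CAlg_cat \<Longrightarrow>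
        Comp Mod_cat (omap Und_functor Y) (omap Und_functor (omap Sym_functor (omap Und_functor Y)))
          (omap Und_functor Y) (amap Und_functor (omap Sym_functor (omap Und_functor Y)) Y (\<epsilon> Y))
          (sym_unit (omap Und_functor Y)) = Ident Mod_cat (omap Und_functor Y)"
    using adjunction by blast
  \<comment> \<open>The triangle identity reads \<open>g \<circ> id = id\<close> on ring components.\<close>
  have counit_vertical: "fst (\<epsilon> (R, A)) = (\<lambda>x\<in>carrier R. x)" if "(R, A) \<in> Ob CAlg_cat" for R A
  proof -
    obtain g \<phi> where g: "\<epsilon> (R, A) = (g, \<phi>)" by (cases "\<epsilon> (R, A)")
    have "g \<in> carrier R \<rightarrow> carrier R" "g \<in> extensional (carrier R)"
      using \<epsilon>(1)[OF that] by (auto simp: g Hom_CAlg ring_hom_funcset)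
    then have "compose (carrier R) g (\<lambda>x\<in>carrier R. x) = g" by (rule compose_Id)
    then show ?thesis
      using \<epsilon>(2)[OF that] by (simp add: g Mod.Comp_C Mod.Ident_C sym_unit_def)
  qed
  let ?Mod = "Mod_cat :: ('u ring \<times> ('u, 'u) module, ('u \<Rightarrow> 'u) \<times> ('u \<Rightarrow> 'u)) category"
  let ?CAlg = "CAlg_cat :: ('u ring \<times> ('u, 'u) module, ('u \<Rightarrow> 'u) \<times> ('u \<Rightarrow> 'u)) category"
  have Sym_over: "fst (amap Sym_functor X Y f) = fst f" for X Y f
    by (cases X; cases Y; cases f) (simp add: Sym_functor_def)
  have "is_functor_over ?Mod CAlg_cat proj_base proj_base Sym_functor"
    using F_functor by (auto simp: is_functor_over_def Sym_over)
  moreover have "is_functor_over CAlg_cat ?Mod proj_base proj_base Und_functor"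
    using Und_is_functor by (auto simp: is_functor_over_def)
  moreover have "\<forall>X\<in>Ob ?Mod. amap proj_base X (omap Und_functor (omap Sym_functor X)) (sym_unit X) =
      Ident Cring_cat (omap proj_base X)"
    by (auto simp: sym_unit_def)
  moreover have "\<forall>Y\<in>Ob ?CAlg. amap proj_base (omap Sym_functor (omap Und_functor Y)) Y (\<epsilon> Y) =
      Ident Cring_cat (omap proj_base Y)"
    using counit_vertical by auto
  ultimately show ?thesis
    unfolding is_adjunction_over_def using adj Mod.fibration CAlg.fibration by blast
qed

end
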